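(* Let $S$ be a symmetry group in dimension $d$ and let $(G,p)\in\mathscr{R}_{(G,S)}$ be a framework in $\mathbb{E}^d$ with $n$ joints. If $p$ is an $S$-regular point of $G$ in $\mathbb{E}^{dn}$, and $(G,q)$ in $\mathbb{H}^{d}$ has symmetry $S^{*}$ with $\pi(q)=p$, then $(G,p)$ has an $S$-symmetric finite flex in $\mathbb{E}^{d}$ if and only if $(G,q)$ has an $S^{*}$-symmetric finite flex in $\mathbb{H}^{d}$.
   Context: A framework $(G,p)$ in $\mathbb{E}^d$ is a finite simple graph $G$ with vertex set $V(G)=\{1,\dots,n\}$ and edge set $E(G)$, together with an injective map $p:V(G)\to\mathbb{E}^d$, identified with a point (configuration) of $\mathbb{E}^{dn}$; $p_i=p(i)$. The edge function is $f_G(p)=(\|p_i-p_j\|^2)_{\{i,j\}\in E(G)}$; $K_n$ denotes the complete graph on $V(G)$. A finite motion of $(G,p)$ is an analytic path $y:[0,1]\to\mathbb{E}^{dn}$ with $y(0)=p$ and $f_G(y(t))=f_G(p)$ for all $t$. It is a finite flex (non-trivial finite motion) if $f_{K_n}(y(t))\ne f_{K_n}(p)$ for all $t\in(0,1]$. A symmetry group in dimension $d$ is a subgroup $S$ of $O(\mathbb{E}^d)$. $\mathscr{R}_{(G,S)}$ is the set of frameworks $(G,p)$ in $\mathbb{E}^d$ for which there is a map $\Phi:S\to\mathrm{Aut}(G)$ with $x(p_i)=p_{\Phi(x)(i)}$ for all $i\in V(G)$, $x\in S$; $\Phi$, the type of $(G,p)$, is unique and a homomorphism since $p$ is injective. $\mathscr{P}_{(G,S,\Phi)}$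 is the linear subspace of all configurations in $\mathbb{E}^{dn}$ satisfying these equations, and $\tilde f_G$ is the restriction of $f_G$ to it. For $(G,p)\in\mathscr{R}_{(G,S)}$ of type $\Phi$, $p$ is an $S$-regular point of $G$ if $\operatorname{rank} d\tilde f_G(p)=\max\{\operatorname{rank} d\tilde f_G(p'):p'\in\mathscr{P}_{(G,S,\Phi)}\}$. An $S$-symmetric finite flex of $(G,p)$ is a finite flex $y$ with $y(t)\in\mathscr{P}_{(G,S,\Phi)}$ for all $t\in[0,1]$. $\mathbb{M}^{d+1}$ is $\mathbb{R}^{d+1}$ with $\|a\|^2_{\mathbb{M}}=a_1^2+\dots+a_d^2-a_{d+1}^2$. Hyperbolic space $\mathbb{H}^d$ is realized on the hyper-hyperboloid $\{a\in\mathbb{M}^{d+1}:\|a\|_{\mathbb{M}}^2=-1\}$ with the metric induced from $\mathbb{M}^{d+1}$. For $x\in S$ with matrix $M_x$, $x^*$ is the isometry of $\mathbb{M}^{d+1}$ with matrix $\begin{pmatrix}M_x&0\\0&1\end{pmatrix}$, and $S^*=\{x^*:x\in S\}$. "$(G,q)$ has symmetry $S^*$" means there is a homomorphism $\Phi^*:S^*\to\mathrm{Aut}(G)$ with $x^*(q_i)=q_{\Phi^*(x^* )(i)}$ for all $i$ and all $x^*\in S^*$. The condition $\pi(q)=p$ means that for each $i\in V(G)$ there is a scalar $\alpha_i\ne0$ with $q_i=\alpha_i(p_i,1)$. A finite flex of $(G,q)$ in $\mathbb{H}^d$ is an analytic path $y:[0,1]\to(\mathbb{H}^d)^n$ with $y(0)=q$,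 $\|y_i(t)-y_j(t)\|^2_{\mathbb{M}}=\|q_i-q_j\|^2_{\mathbb{M}}$ for all $\{i,j\}\in E(G)$ and all $t$, and such that for each $t\in(0,1]$ this equality fails for some pair $i,j\in V(G)$; it is $S^*$-symmetric if $x^*(y_i(t))=y_{\Phi^*(x^* )(i)}(t)$ for all $i$, all $x^*\in S^*$ and all $t$. *)

theory Defs
  imports "HOL-Analysis.Analysis" "HOL-Algebra.Group"
begin

section \<open>Graphs\<close>

text \<open>
  A graph on the vertex set \<open>UNIV :: 'n set\<close>, where \<open>'n\<close> is a finite type with \<open>n\<close> elements,
  is given by its set of edges, each edge being a set of two vertices.
\<close>

definition simple_graph :: "'n::finite set set \<Rightarrow> bool" where
  "simple_graph E \<longleftrightarrow> (\<forall>e\<in>E. card e = 2)"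

definition complete_graph :: "'n::finite set set" where
  "complete_graph = {e. card e = 2}"

definition Aut :: "'n::finite set set \<Rightarrow> ('n \<Rightarrow> 'n) monoid" where
  "Aut E = \<lparr>carrier = {\<sigma>. bij \<sigma> \<and> (\<forall>i j. {i, j} \<in> E \<longleftrightarrow> {\<sigma> i, \<sigma> j} \<in> E)},
            mult = (\<circ>), one = id\<rparr>"

section \<open>Analytic paths\<close>

text \<open>
  Real-analyticity on a set of parameters: near every point of \<open>I\<close> the path is given on \<open>I\<close> by a
  convergent power series. For \<open>I = {0..1}\<close> this is the same as having a real-analytic extension
  to an open interval containing \<open>{0..1}\<close>.
\<close>

definition analytic_path_on :: "real set \<Rightarrow> (real \<Rightarrow> 'a::real_normed_vector) \<Rightarrow> bool" where
  "analytic_path_on I y \<longleftrightarrow>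
    (\<forall>t0\<in>I. \<exists>r>0. \<exists>a. \<forall>t\<in>I. \<bar>t - t0\<bar> < r \<longrightarrow> (\<lambda>k. (t - t0) ^ k *\<^sub>R a k) sums y t)"

section \<open>Frameworks in Euclidean space\<close>

definition framework :: "'n::finite set set \<Rightarrow> real^'d^'n \<Rightarrow> bool" where
  "framework E p \<longleftrightarrow> simple_graph E \<and> inj (($) p)"

text \<open>
  The edge function takes values in the space indexed by all sets of vertices; the
  components outside \<open>E\<close> are identically zero. The double sum over \<open>e = {i, j}\<close> counts the one
  squared distance twice.
\<close>

definition edge_function :: "'n::finite set set \<Rightarrow> real^'d^'n \<Rightarrow> real^('n set)" where
  "edge_function E p =
    (\<chi> e. if e \<in> E then (\<Sum>i\<in>e. \<Sum>j\<in>e. (norm (p $ i - p $ j))\<^sup>2) / 2 else 0)"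

lemma edge_function_edge:
  assumes "{i, j} \<in> E"
  shows "edge_function E p $ {i, j} = (norm (p $ i - p $ j))\<^sup>2"
  using assms by (cases "i = j") (simp_all add: edge_function_def norm_minus_commute)

definition finite_motion ::
    "'n::finite set set \<Rightarrow> real^'d^'n \<Rightarrow> (real \<Rightarrow> real^'d^'n) \<Rightarrow> bool" where
  "finite_motion E p y \<longleftrightarrow> analytic_path_on {0..1} y \<and> y 0 = p \<and>
     (\<forall>t\<in>{0..1}. edge_function E (y t) = edge_function E p)"

definition finite_flex ::
    "'n::finite set set \<Rightarrow> real^'d^'n \<Rightarrow> (real \<Rightarrow> real^'d^'n) \<Rightarrow> bool" where
  "finite_flex E p y \<longleftrightarrow> finite_motion E p y \<and>
     (\<forall>t\<in>{0<..1}. edge_function complete_graph (y t) \<noteq> edge_function complete_graph p)"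

section \<open>Symmetric frameworks in Euclidean space\<close>

definition orthogonal_group :: "(real^'d \<Rightarrow> real^'d) monoid" where
  "orthogonal_group = \<lparr>carrier = {x. orthogonal_transformation x}, mult = (\<circ>), one = id\<rparr>"

abbreviation symmetry_group :: "(real^'d \<Rightarrow> real^'d) set \<Rightarrow> bool" where
  "symmetry_group S \<equiv> subgroup S orthogonal_group"

definition is_type :: "'n::finite set set \<Rightarrow> (real^'d \<Rightarrow> real^'d) set \<Rightarrow> real^'d^'n \<Rightarrow>
    ((real^'d \<Rightarrow> real^'d) \<Rightarrow> 'n \<Rightarrow> 'n) \<Rightarrow> bool" where
  "is_type E S p \<Phi> \<longleftrightarrow> \<Phi> \<in> S \<rightarrow> carrier (Aut E) \<and> (\<forall>x\<in>S. \<forall>i. x (p $ i) = p $ \<Phi> x i)"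

definition symmetric_frameworks ::
    "'n::finite set set \<Rightarrow> (real^'d \<Rightarrow> real^'d) set \<Rightarrow> (real^'d^'n) set" where
  "symmetric_frameworks E S = {p. framework E p \<and> (\<exists>\<Phi>. is_type E S p \<Phi>)}"

definition symmetric_configurations :: "(real^'d \<Rightarrow> real^'d) set \<Rightarrow>
    ((real^'d \<Rightarrow> real^'d) \<Rightarrow> 'n::finite \<Rightarrow> 'n) \<Rightarrow> (real^'d^'n) set" where
  "symmetric_configurations S \<Phi> = {p. \<forall>x\<in>S. \<forall>i. x (p $ i) = p $ \<Phi> x i}"

text \<open>
  The rank of the differential at \<open>p\<close> of the edge function restricted to the linear subspace
  \<open>symmetric_configurations S \<Phi>\<close>. The derivative within a subspace is determined
  only on that subspace, which is also the tangent space at \<open>p\<close>, so the image is taken of the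
  subspace alone.
\<close>

definition symmetric_rank :: "'n::finite set set \<Rightarrow> (real^'d \<Rightarrow> real^'d) set \<Rightarrow>
    ((real^'d \<Rightarrow> real^'d) \<Rightarrow> 'n \<Rightarrow> 'n) \<Rightarrow> real^'d^'n \<Rightarrow> nat" where
  "symmetric_rank E S \<Phi> p =
     dim (frechet_derivative (edge_function E) (at p within symmetric_configurations S \<Phi>) `
            symmetric_configurations S \<Phi>)"

definition S_regular :: "'n::finite set set \<Rightarrow> (real^'d \<Rightarrow> real^'d) set \<Rightarrow>
    ((real^'d \<Rightarrow> real^'d) \<Rightarrow> 'n \<Rightarrow> 'n) \<Rightarrow> real^'d^'n \<Rightarrow> bool" where
  "S_regular E S \<Phi> p \<longleftrightarrow>
     symmetric_rank E S \<Phi> p = Max (symmetric_rank E S \<Phi> ` symmetric_configurations S \<Phi>)"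

definition symmetric_finite_flex :: "'n::finite set set \<Rightarrow> (real^'d \<Rightarrow> real^'d) set \<Rightarrow>
    ((real^'d \<Rightarrow> real^'d) \<Rightarrow> 'n \<Rightarrow> 'n) \<Rightarrow> real^'d^'n \<Rightarrow> (real \<Rightarrow> real^'d^'n) \<Rightarrow> bool" where
  "symmetric_finite_flex E S \<Phi> p y \<longleftrightarrow>
     finite_flex E p y \<and> (\<forall>t\<in>{0..1}. y t \<in> symmetric_configurations S \<Phi>)"

section \<open>Frameworks in hyperbolic space\<close>

text \<open>
  The Minkowski space of dimension \<open>d + 1\<close> is \<open>(real^'d) \<times> real\<close>, the second component being the
  last coordinate. The hyper-hyperboloid includes both of its sheets.
\<close>

definition minkowski_sq :: "(real^'d) \<times> real \<Rightarrow> real" where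
  "minkowski_sq a = (norm (fst a))\<^sup>2 - (snd a)\<^sup>2"

definition hyperbolic_space :: "((real^'d) \<times> real) set" where
  "hyperbolic_space = {a. minkowski_sq a = -1}"

definition hyperbolic_framework :: "'n::finite set set \<Rightarrow> ((real^'d) \<times> real)^'n \<Rightarrow> bool" where
  "hyperbolic_framework E q \<longleftrightarrow>
     simple_graph E \<and> inj (($) q) \<and> (\<forall>i. q $ i \<in> hyperbolic_space)"

definition star :: "(real^'d \<Rightarrow> real^'d) \<Rightarrow> (real^'d) \<times> real \<Rightarrow> (real^'d) \<times> real" where
  "star x = (\<lambda>(v, s). (x v, s))"

definition star_group ::
    "(real^'d \<Rightarrow> real^'d) set \<Rightarrow> ((real^'d) \<times> real \<Rightarrow> (real^'d) \<times> real) monoid" where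
  "star_group S = \<lparr>carrier = star ` S, mult = (\<circ>), one = id\<rparr>"

definition is_hyperbolic_type :: "'n::finite set set \<Rightarrow> (real^'d \<Rightarrow> real^'d) set \<Rightarrow>
    ((real^'d) \<times> real)^'n \<Rightarrow>
    (((real^'d) \<times> real \<Rightarrow> (real^'d) \<times> real) \<Rightarrow> 'n \<Rightarrow> 'n) \<Rightarrow> bool" where
  "is_hyperbolic_type E S q \<Psi> \<longleftrightarrow> \<Psi> \<in> hom (star_group S) (Aut E) \<and>
     (\<forall>z\<in>carrier (star_group S). \<forall>i. z (q $ i) = q $ \<Psi> z i)"

definition projects_to :: "((real^'d) \<times> real)^'n \<Rightarrow> real^'d^'n::finite \<Rightarrow> bool" where
  "projects_to q p \<longleftrightarrow> (\<forall>i. \<exists>\<alpha>. \<alpha> \<noteq> 0 \<and> q $ i = \<alpha> *\<^sub>R (p $ i, 1))"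

definition hyperbolic_finite_flex :: "'n::finite set set \<Rightarrow> ((real^'d) \<times> real)^'n \<Rightarrow>
    (real \<Rightarrow> ((real^'d) \<times> real)^'n) \<Rightarrow> bool" where
  "hyperbolic_finite_flex E q y \<longleftrightarrow>
     analytic_path_on {0..1} y \<and> (\<forall>t\<in>{0..1}. \<forall>i. y t $ i \<in> hyperbolic_space) \<and> y 0 = q \<and>
     (\<forall>t\<in>{0..1}. \<forall>i j. {i, j} \<in> E \<longrightarrow>
        minkowski_sq (y t $ i - y t $ j) = minkowski_sq (q $ i - q $ j)) \<and>
     (\<forall>t\<in>{0<..1}. \<exists>i j. minkowski_sq (y t $ i - y t $ j) \<noteq> minkowski_sq (q $ i - q $ j))"

definition symmetric_hyperbolic_finite_flex :: "'n::finite set set \<Rightarrow>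
    (real^'d \<Rightarrow> real^'d) set \<Rightarrow>
    (((real^'d) \<times> real \<Rightarrow> (real^'d) \<times> real) \<Rightarrow> 'n \<Rightarrow> 'n) \<Rightarrow>
    ((real^'d) \<times> real)^'n \<Rightarrow> (real \<Rightarrow> ((real^'d) \<times> real)^'n) \<Rightarrow> bool" where
  "symmetric_hyperbolic_finite_flex E S \<Psi> q y \<longleftrightarrow> hyperbolic_finite_flex E q y \<and>
     (\<forall>t\<in>{0..1}. \<forall>z\<in>carrier (star_group S). \<forall>i. z (y t $ i) = y t $ \<Psi> z i)"

end

theory Submission
  imports Defs "HOL-Complex_Analysis.Cauchy_Integral_Formula"
begin

text \<open>
  Both existence statements are equivalent to one linear condition on \<open>p\<close>: that \<open>p\<close> has a symmetric
  infinitesimal motion (a symmetric velocity preserving the edge lengths to first order) that is not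
  trivial.

  Passage between the geometries. If \<open>q\<^sub>i = \<alpha>\<^sub>i (p\<^sub>i, 1)\<close>, then
  \<open>u\<^sub>i \<mapsto> \<alpha>\<^sub>i (u\<^sub>i, p\<^sub>i \<bullet> u\<^sub>i)\<close> is an isomorphism from the symmetric infinitesimal motions of \<open>p\<close> onto those of \<open>q\<close>
  (\<open>velocity_lift_image_kernel\<close>). This holds at every \<open>q\<close> with nonzero last coordinates and for every
  graph, so it carries the maximality of the rank at \<open>p\<close> over to a neighbourhood of \<open>q\<close>,
  and it matches the velocities that preserve all pairs.

  From velocities to flexes (\<open>symmetric_form_flex\<close>). In both geometries the constraints are quadratic
  equations \<open>B y y = B p p\<close> on a linear space of symmetric configurations; on the hyperbolic side the
  equations of the hyperboloid are included. Where the rank is locally maximal, every infinitesimal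
  motion \<open>u\<close> is the initial velocity of an analytic solution. Since the equations are quadratic, the
  coefficients of the solution are given by a convolution recursion that is easily majorised.
  If the solution were congruent to its initial position at arbitrarily small positive times, then \<open>u\<close>
  would preserve all distances to first order and respect all dependencies between the
  points, that is, \<open>u\<close> would be trivial (\<open>symmetric_finite_flex_exists\<close>,
  \<open>symmetric_hyperbolic_flex_exists\<close>).

  From rigidity to the absence of flexes. If all symmetric infinitesimal motions of \<open>p\<close> are trivial,
  they come from symmetric Killing fields (\<open>trivial_velocity_killing\<close>). These fields act on
  nearby configurations as well, and by compactness they give all symmetric infinitesimal motions there
  (\<open>rigid_near_rigid\<close>). The velocity of a symmetric motion of \<open>p\<close> is thus trivial at all small times, so all
  pairwise distances stay constant (\<open>analytic_motion_preserves_form\<close>). By the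
  isomorphism above the same applies to motions of \<open>q\<close>.
\<close>

section \<open>Power series with values in a Euclidean space\<close>

text \<open>
  The sum of the power series with vector coefficients \<open>a k\<close> at the real parameter \<open>t\<close>.
\<close>

definition power_series :: "(nat \<Rightarrow> 'a::euclidean_space) \<Rightarrow> real \<Rightarrow> 'a" where
  "power_series a t = (\<Sum>k. t ^ k *\<^sub>R a k)"

lemma power_series_summable_norm:
  fixes a :: "nat \<Rightarrow> 'a::euclidean_space"
  assumes "summable (\<lambda>k. norm (a k) * R ^ k)" and "\<bar>t\<bar> \<le> R"
  shows "summable (\<lambda>k. norm (t ^ k *\<^sub>R a k))"
proof (rule summable_comparison_test[OF _ assms(1)])
  have "\<bar>t\<bar> ^ n \<le> R ^ n" for n
    using assms(2) by (intro power_mono) auto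
  then have "\<bar>t\<bar> ^ n * norm (a n) \<le> R ^ n * norm (a n)" for n
    by (rule mult_right_mono) simp
  then show "\<exists>N. \<forall>n\<ge>N. norm (norm (t ^ n *\<^sub>R a n)) \<le> norm (a n) * R ^ n"
    by (simp add: power_abs mult.commute)
qed

lemma power_series_sums:
  fixes a :: "nat \<Rightarrow> 'a::euclidean_space"
  assumes "summable (\<lambda>k. norm (a k) * R ^ k)" and "\<bar>t\<bar> \<le> R"
  shows "(\<lambda>k. t ^ k *\<^sub>R a k) sums power_series a t"
  unfolding power_series_def
  by (rule summable_sums[OF summable_norm_cancel[OF power_series_summable_norm[OF assms]]])

lemma power_series_inner_sums:
  fixes a :: "nat \<Rightarrow> 'a::euclidean_space"
  assumes "summable (\<lambda>k. norm (a k) * R ^ k)" and "\<bar>t\<bar> \<le> R"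
  shows "(\<lambda>k. (a k \<bullet> b) * t ^ k) sums (power_series a t \<bullet> b)"
proof -
  have "(\<lambda>k. (t ^ k *\<^sub>R a k) \<bullet> b) sums (power_series a t \<bullet> b)"
    by (rule bounded_linear.sums[OF bounded_linear_inner_left power_series_sums[OF assms]])
  then show ?thesis
    by (simp add: mult.commute)
qed

lemma power_series_zero [simp]: "power_series a 0 = a 0"
proof -
  have "(\<lambda>k. 0 ^ k *\<^sub>R a k) sums (\<Sum>k\<in>{0}. 0 ^ k *\<^sub>R a k)"
    by (rule sums_finite) auto
  then show ?thesis
    by (simp add: power_series_def sums_iff)
qed

lemma power_series_has_vector_derivative:
  fixes a :: "nat \<Rightarrow> 'a::euclidean_space"
  assumes "summable (\<lambda>k. norm (a k) * R ^ k)" and "\<bar>t\<bar> < R"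
  shows "(power_series a has_vector_derivative power_series (\<lambda>k. real (Suc k) *\<^sub>R a (Suc k)) t) (at t)"
proof -
  have comp: "(((\<lambda>t. power_series a t \<bullet> b)) has_real_derivative
      (\<Sum>k. diffs (\<lambda>k. a k \<bullet> b) k * t ^ k)) (at t)" for b
  proof -
    have "((\<lambda>x. \<Sum>k. (a k \<bullet> b) * x ^ k) has_real_derivative
        (\<Sum>k. diffs (\<lambda>k. a k \<bullet> b) k * t ^ k)) (at t)"
      using assms power_series_inner_sums[OF assms(1), of R b]
      by (intro termdiffs_strong[of _ R]) (auto simp: sums_iff)
    then show ?thesis
    proof (rule has_field_derivative_transform_within_open)
      show "open {-R<..<R}" "t \<in> {-R<..<R}"
        using assms(2) by auto
      show "\<And>x. x \<in> {-R<..<R} \<Longrightarrow> (\<Sum>k. (a k \<bullet> b) * x ^ k) = power_series a x \<bullet> b"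
        using power_series_inner_sums[OF assms(1)] by (auto simp: sums_iff)
    qed
  qed
  have diffs: "(\<lambda>k. diffs (\<lambda>k. a k \<bullet> b) k * t ^ k) sums (\<Sum>k. diffs (\<lambda>k. a k \<bullet> b) k * t ^ k)" for b
    by (intro summable_sums termdiff_converges[of _ R])
      (use assms power_series_inner_sums[OF assms(1)] in \<open>auto simp: sums_iff\<close>)
  define d where "d = (\<Sum>b\<in>Basis. (\<Sum>k. diffs (\<lambda>k. a k \<bullet> b) k * t ^ k) *\<^sub>R b)"
  have "(\<lambda>k. \<Sum>b\<in>Basis. (diffs (\<lambda>k. a k \<bullet> b) k * t ^ k) *\<^sub>R b) sums d"
    unfolding d_def by (intro sums_sum bounded_linear.sums[OF bounded_linear_scaleR_left] diffs)
  moreover have "(\<Sum>b\<in>Basis. (diffs (\<lambda>k. a k \<bullet> b) k * t ^ k) *\<^sub>R b) = t ^ k *\<^sub>R real (Suc k) *\<^sub>R a (Suc k)" for k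
  proof -
    have "(\<Sum>b\<in>Basis. (diffs (\<lambda>k. a k \<bullet> b) k * t ^ k) *\<^sub>R b)
        = (t ^ k * real (Suc k)) *\<^sub>R (\<Sum>b\<in>Basis. (a (Suc k) \<bullet> b) *\<^sub>R b)"
      unfolding scaleR_sum_right by (simp add: diffs_def mult_ac)
    then show ?thesis
      by (simp add: euclidean_representation)
  qed
  ultimately have d: "power_series (\<lambda>k. real (Suc k) *\<^sub>R a (Suc k)) t = d"
    unfolding power_series_def by (simp add: sums_iff)
  have "((\<lambda>t. \<Sum>b\<in>Basis. (power_series a t \<bullet> b) *\<^sub>R b) has_vector_derivative d) (at t)"
    unfolding d_def
  proof (rule has_vector_derivative_sum)
    fix b :: 'a
    show "((\<lambda>t. (power_series a t \<bullet> b) *\<^sub>R b) has_vector_derivative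
        (\<Sum>k. diffs (\<lambda>k. a k \<bullet> b) k * t ^ k) *\<^sub>R b) (at t)"
      using has_vector_derivative_scaleR[OF comp has_vector_derivative_const] by simp
  qed
  then show ?thesis
    by (simp only: euclidean_representation d)
qed

lemma bilinear_Cauchy_product_sums:
  fixes h :: "'a::euclidean_space \<Rightarrow> 'b::euclidean_space \<Rightarrow> 'c::real_normed_vector"
  assumes h: "bilinear h"
    and a: "summable (\<lambda>k. norm (a k))" and c: "summable (\<lambda>k. norm (c k))"
  shows "(\<lambda>k. \<Sum>i\<le>k. h (a i) (c (k - i))) sums h (\<Sum>k. a k) (\<Sum>k. c k)"
proof -
  have expand: "h x y = (\<Sum>b\<in>Basis. \<Sum>b'\<in>Basis. ((x \<bullet> b) * (y \<bullet> b')) *\<^sub>R h b b')" for x y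
  proof -
    have "h (\<Sum>b\<in>Basis. (x \<bullet> b) *\<^sub>R b) (\<Sum>b\<in>Basis. (y \<bullet> b) *\<^sub>R b)
        = (\<Sum>b\<in>Basis. \<Sum>b'\<in>Basis. ((x \<bullet> b) * (y \<bullet> b')) *\<^sub>R h b b')"
      by (simp add: bilinear_sum[OF h] sum.cartesian_product bilinear_lmul[OF h] bilinear_rmul[OF h]
          split_def mult.commute)
    then show ?thesis
      by (simp add: euclidean_representation)
  qed
  have inner_norm: "summable (\<lambda>k. norm (u k \<bullet> b))"
    if "summable (\<lambda>k. norm (u k))" "b \<in> Basis" for u :: "nat \<Rightarrow> 'x::euclidean_space" and b
    using that by (intro summable_comparison_test[OF _ that(1)]) (auto simp: Basis_le_norm)
  have inner_sum: "(\<Sum>k. u k \<bullet> b) = (\<Sum>k. u k) \<bullet> b"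
    if "summable (\<lambda>k. norm (u k))" for u :: "nat \<Rightarrow> 'x::euclidean_space" and b
    using bounded_linear.suminf[OF bounded_linear_inner_left summable_norm_cancel[OF that]] by simp
  have "(\<lambda>k. \<Sum>b\<in>Basis. \<Sum>b'\<in>Basis. (\<Sum>i\<le>k. (a i \<bullet> b) * (c (k - i) \<bullet> b')) *\<^sub>R h b b')
      sums (\<Sum>b\<in>Basis. \<Sum>b'\<in>Basis. ((\<Sum>k. a k \<bullet> b) * (\<Sum>k. c k \<bullet> b')) *\<^sub>R h b b')"
    by (intro sums_sum bounded_linear.sums[OF bounded_linear_scaleR_left] Cauchy_product_sums
        inner_norm a c)
  moreover have "(\<Sum>b\<in>Basis. \<Sum>b'\<in>Basis. (\<Sum>i\<le>k. (a i \<bullet> b) * (c (k - i) \<bullet> b')) *\<^sub>R h b b')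
      = (\<Sum>i\<le>k. h (a i) (c (k - i)))" for k
  proof -
    have "(\<Sum>i\<le>k. h (a i) (c (k - i)))
        = (\<Sum>i\<le>k. \<Sum>b\<in>Basis. \<Sum>b'\<in>Basis. ((a i \<bullet> b) * (c (k - i) \<bullet> b')) *\<^sub>R h b b')"
      by (rule sum.cong[OF refl]) (rule expand)
    also have "\<dots> = (\<Sum>b\<in>Basis. \<Sum>i\<le>k. \<Sum>b'\<in>Basis. ((a i \<bullet> b) * (c (k - i) \<bullet> b')) *\<^sub>R h b b')"
      by (rule sum.swap)
    also have "\<dots> = (\<Sum>b\<in>Basis. \<Sum>b'\<in>Basis. (\<Sum>i\<le>k. (a i \<bullet> b) * (c (k - i) \<bullet> b')) *\<^sub>R h b b')"
      by (subst sum.swap) (simp add: scaleR_sum_left)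
    finally show ?thesis by simp
  qed
  ultimately show ?thesis
    by (simp add: inner_sum a c expand[of "\<Sum>k. a k"])
qed

text \<open>
  A power series can be expanded again about each point of its interval of convergence. This is
  obtained coordinatewise: the coordinate series extends to a holomorphic function on a complex
  disc, whose Taylor coefficients at a real point have the required coefficients as real parts.
\<close>

lemma power_series_analytic_path:
  fixes a :: "nat \<Rightarrow> 'a::euclidean_space"
  assumes a: "summable (\<lambda>k. norm (a k) * R ^ k)" and s: "0 < s" "s < R"
  shows "analytic_path_on {0..1} (\<lambda>t. power_series a (s * t))"
  unfolding analytic_path_on_def
proof
  fix t0 :: real
  assume t0: "t0 \<in> {0..1}"
  define F where "F b z = (\<Sum>k. of_real (a k \<bullet> b) * z ^ k)" for b :: 'a and z :: complex
  have F: "(\<lambda>k. of_real (a k \<bullet> b) * (z - 0) ^ k) sums F b z" if "z \<in> ball 0 R" for b z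
  proof -
    have "summable (\<lambda>k. complex_of_real (a k \<bullet> b) * of_real R ^ k)"
    proof -
      have "summable (\<lambda>k. complex_of_real ((a k \<bullet> b) * R ^ k))"
        using power_series_inner_sums[OF a, of R b] s by (intro summable_of_real sums_summable) auto
      then show ?thesis by simp
    qed
    then have "summable (\<lambda>k. of_real (a k \<bullet> b) * z ^ k)"
      using that s by (rule_tac powser_inside[of _ "of_real R"]) auto
    then show ?thesis
      unfolding F_def by (auto intro: summable_sums)
  qed
  have Freal: "F b (of_real x) = of_real (power_series a x \<bullet> b)" if "\<bar>x\<bar> < R" for b x
  proof -
    have "(\<lambda>k. complex_of_real ((a k \<bullet> b) * x ^ k)) sums of_real (power_series a x \<bullet> b)"
      using power_series_inner_sums[OF a, of x b] that by (intro sums_of_real) auto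
    then have "(\<lambda>k. of_real (a k \<bullet> b) * (complex_of_real x - 0) ^ k) sums of_real (power_series a x \<bullet> b)"
      by simp
    moreover have "of_real x \<in> ball (0::complex) R"
      using that by simp
    ultimately show ?thesis
      using F sums_unique2 by blast
  qed
  have st: "s * t0 < R" "0 \<le> s * t0"
    using t0 s by (auto intro: le_less_trans[of _ s] simp: mult_left_le)
  define w where "w b k = (deriv ^^ k) (F b) (of_real (s * t0)) / fact k" for b k
  define c where "c b k = Re (w b k)" for b k
  have expansion: "(\<lambda>k. c b k * (x - s * t0) ^ k) sums (power_series a x \<bullet> b)"
    if "\<bar>x - s * t0\<bar> < R - s * t0" for x b
  proof -
    have "F b holomorphic_on ball 0 R"
      by (rule power_series_holomorphic[OF F])
    moreover have "ball (of_real (s * t0)) (R - s * t0) \<subseteq> ball (0::complex) R"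
    proof
      fix z :: complex
      assume "z \<in> ball (of_real (s * t0)) (R - s * t0)"
      then have "norm (z - of_real (s * t0)) < R - s * t0"
        by (simp add: dist_norm norm_minus_commute)
      then have "norm z < R"
        using norm_triangle_sub[of z "of_real (s * t0)"] st by (simp add: norm_mult del: of_real_mult)
      then show "z \<in> ball 0 R" by simp
    qed
    ultimately have "F b holomorphic_on ball (of_real (s * t0)) (R - s * t0)"
      using holomorphic_on_subset by blast
    moreover have "of_real x \<in> ball (complex_of_real (s * t0)) (R - s * t0)"
      using that by (simp add: dist_of_real dist_real_def abs_minus_commute del: of_real_mult)
    ultimately have "(\<lambda>k. (deriv ^^ k) (F b) (of_real (s * t0)) / fact k
        * (of_real x - of_real (s * t0)) ^ k) sums F b (of_real x)"
      by (rule holomorphic_power_series)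
    then have "(\<lambda>k. w b k * of_real ((x - s * t0) ^ k)) sums of_real (power_series a x \<bullet> b)"
      using that st by (subst (asm) Freal) (auto simp: w_def)
    from sums_Re[OF this] show ?thesis
      unfolding c_def by (simp del: of_real_power)
  qed
  define e where "e k = s ^ k *\<^sub>R (\<Sum>b\<in>Basis. c b k *\<^sub>R b)" for k
  have "(\<lambda>k. (t - t0) ^ k *\<^sub>R e k) sums power_series a (s * t)"
    if "\<bar>t - t0\<bar> < (R - s * t0) / s" for t
  proof -
    have "\<bar>s * t - s * t0\<bar> = s * \<bar>t - t0\<bar>"
      using s by (simp add: abs_mult flip: right_diff_distrib)
    then have "\<bar>s * t - s * t0\<bar> < R - s * t0"
      using that s by (simp add: pos_less_divide_eq mult.commute)
    then have "(\<lambda>k. \<Sum>b\<in>Basis. (c b k * (s * t - s * t0) ^ k) *\<^sub>R b)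
        sums (\<Sum>b\<in>Basis. (power_series a (s * t) \<bullet> b) *\<^sub>R b)"
      by (intro sums_sum bounded_linear.sums[OF bounded_linear_scaleR_left] expansion)
    moreover have "(\<Sum>b\<in>Basis. (c b k * (s * t - s * t0) ^ k) *\<^sub>R b) = (t - t0) ^ k *\<^sub>R e k" for k
    proof -
      have "(s * t - s * t0) ^ k = (t - t0) ^ k * s ^ k"
        unfolding right_diff_distrib[symmetric] power_mult_distrib by simp
      then show ?thesis
        unfolding e_def scaleR_sum_right by (simp add: mult_ac)
    qed
    ultimately show ?thesis
      by (simp add: euclidean_representation)
  qed
  moreover have "0 < (R - s * t0) / s"
    using s st by simp
  ultimately show "\<exists>r>0. \<exists>e. \<forall>t\<in>{0..1}. \<bar>t - t0\<bar> < r \<longrightarrow> (\<lambda>k. (t - t0) ^ k *\<^sub>R e k) sums power_series a (s * t)"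
    by blast
qed

section \<open>Analytic motions under quadratic constraints of constant rank\<close>

text \<open>
  If differences \<open>y s - y t\<close> lie in a subspace for parameters \<open>s\<close> arbitrarily near \<open>t\<close>, so does
  the derivative at \<open>t\<close>. No regularity of the set of such \<open>s\<close> is needed; in particular a
  sequence of parameters tending to \<open>t\<close> is enough.
\<close>

lemma vector_derivative_in_subspace:
  fixes y :: "real \<Rightarrow> 'a::euclidean_space"
  assumes y: "(y has_vector_derivative d) (at t within X)" and U: "subspace U"
    and freq: "\<exists>\<^sub>F s in at t within X. y s - y t \<in> U"
  shows "d \<in> U"
proof -
  obtain z w where d: "d = z + w" and z: "z \<in> span U" and w: "\<And>v. v \<in> span U \<Longrightarrow> orthogonal w v"
    using orthogonal_subspace_decomp_exists[of U d] by metis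
  have "((\<lambda>t. y t \<bullet> w) has_vector_derivative (d \<bullet> w)) (at t within X)"
    using y by (rule bounded_linear.has_vector_derivative[OF bounded_linear_inner_left])
  then have lim: "((\<lambda>s. (y s \<bullet> w - y t \<bullet> w) / (s - t)) \<longlongrightarrow> d \<bullet> w) (at t within X)"
    by (simp add: has_real_derivative_iff_has_vector_derivative[symmetric] has_field_derivative_iff)
  have "d \<bullet> w = 0"
  proof (rule ccontr)
    assume "d \<bullet> w \<noteq> 0"
    with lim have "\<forall>\<^sub>F s in at t within X. (y s \<bullet> w - y t \<bullet> w) / (s - t) \<noteq> 0"
      by (rule tendsto_imp_eventually_ne)
    with freq have "\<exists>\<^sub>F s in at t within X. y s - y t \<in> U \<and> (y s \<bullet> w - y t \<bullet> w) / (s - t) \<noteq> 0"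
      by (rule frequently_eventually_frequently)
    then obtain s where "y s - y t \<in> U" "y s \<bullet> w - y t \<bullet> w \<noteq> 0"
      by (auto dest!: frequently_ex)
    then show False
      using w[of "y s - y t"] by (simp add: span_base orthogonal_def inner_commute inner_diff_right)
  qed
  moreover have "z \<bullet> w = 0"
    using w[OF z] by (simp add: orthogonal_def inner_commute)
  ultimately have "w = 0"
    by (simp add: d inner_add_left)
  then show ?thesis
    using d z U by (simp add: span_eq_iff[THEN iffD2])
qed

lemma vector_derivative_eq_zero:
  fixes y :: "real \<Rightarrow> 'a::euclidean_space"
  assumes "(y has_vector_derivative d) (at t within X)" and "\<exists>\<^sub>F s in at t within X. y s = y t"
  shows "d = 0"
  using vector_derivative_in_subspace[OF assms(1) subspace_single_0] assms(2) by simp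

text \<open>
  For a symmetric bilinear \<open>B\<close> the derivative of \<open>x \<mapsto> B x x\<close> at \<open>x\<close> is \<open>2 B x\<close>. Hence
  \<open>form_kernel U B x\<close> is the space of infinitesimal motions at \<open>x\<close>, inside the space \<open>U\<close> of
  configurations, of the constraint that \<open>B x x\<close> stays constant.
\<close>

definition form_kernel :: "'a::real_vector set \<Rightarrow> ('a \<Rightarrow> 'a \<Rightarrow> 'b::real_vector) \<Rightarrow> 'a \<Rightarrow> 'a set" where
  "form_kernel U B x = {v \<in> U. B x v = 0}"

lemma subspace_form_kernel:
  assumes "subspace U" and "bilinear B"
  shows "subspace (form_kernel U B x)"
  using assms by (auto simp: form_kernel_def subspace_def bilinear_radd bilinear_rmul bilinear_rzero)

lemmas [fundef_cong] = sum.cong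

text \<open>
  The coefficients of the formal power series \<open>y = p + t u + \<dots>\<close> that solves \<open>h y y = h p p\<close>,
  where \<open>h\<close> is symmetric, \<open>h p u = 0\<close> and \<open>h p\<close> is the identity on the values of \<open>h\<close>: comparing coefficients of
  \<open>t ^ k\<close> for \<open>k \<ge> 2\<close> gives twice the \<open>k\<close>-th coefficient as minus a convolution of earlier ones.
\<close>

fun flex_coeff :: "('a::real_vector \<Rightarrow> 'a \<Rightarrow> 'a) \<Rightarrow> 'a \<Rightarrow> 'a \<Rightarrow> nat \<Rightarrow> 'a" where
  "flex_coeff h p u k =
    (if k = 0 then p else if k = 1 then u
     else - (1/2) *\<^sub>R (\<Sum>i\<in>{1..<k}. h (flex_coeff h p u i) (flex_coeff h p u (k - i))))"

declare flex_coeff.simps [simp del]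

lemma convolution_sum_le:
  fixes f :: "nat \<Rightarrow> real"
  assumes "\<And>k. 0 \<le> f k"
  shows "(\<Sum>k = 2..Suc n. \<Sum>i = 1..<k. f i * f (k - i)) \<le> (\<Sum>k = 1..n. f k)\<^sup>2"
proof -
  have "(\<Sum>k = 2..Suc n. \<Sum>i = 1..<k. f i * f (k - i))
      = (\<Sum>(k, i)\<in>Sigma {2..Suc n} (\<lambda>k. {1..<k}). f i * f (k - i))"
    by (rule sum.Sigma) auto
  also have "\<dots> \<le> (\<Sum>(i, j)\<in>{1..n} \<times> {1..n}. f i * f j)"
  proof (rule sum_le_included[where i = "\<lambda>(i, j). (i + j, i)"], goal_cases)
    case 4
    show ?case
    proof
      fix x
      assume x: "x \<in> Sigma {2..Suc n} (\<lambda>k. {1..<k})"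
      then show "\<exists>y\<in>{1..n} \<times> {1..n}. (\<lambda>(i, j). (i + j, i)) y = x
          \<and> (\<lambda>(k, i). f i * f (k - i)) x \<le> (\<lambda>(i, j). f i * f j) y"
        by (intro bexI[of _ "(snd x, fst x - snd x)"]) auto
    qed
  qed (auto simp: assms)
  also have "\<dots> = (\<Sum>k = 1..n. f k)\<^sup>2"
    by (simp add: power2_eq_square sum_product sum.cartesian_product)
  finally show ?thesis .
qed

text \<open>
  The series has positive radius of convergence. The sum \<open>s n\<close> of the terms
  \<open>norm (flex_coeff h p u k) * R ^ k\<close> with \<open>1 \<le> k \<le> n\<close> satisfies
  \<open>s (Suc n) \<le> norm u * R + M / 2 * (s n)\<^sup>2\<close>, and for small \<open>R\<close> this recursion keeps it below
  \<open>2 * norm u * R\<close>.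
\<close>

lemma flex_coeff_summable:
  fixes h :: "'a::real_normed_vector \<Rightarrow> 'a \<Rightarrow> 'a"
  assumes h: "\<And>x y. norm (h x y) \<le> M * norm x * norm y" and M: "0 < M" and R: "0 \<le> R" "2 * M * norm u * R \<le> 1"
  shows "summable (\<lambda>k. norm (flex_coeff h p u k) * R ^ k)"
proof -
  define f where "f k = norm (flex_coeff h p u k) * R ^ k" for k
  have f0: "0 \<le> f k" for k
    using R by (simp add: f_def)
  have f1: "f 1 = norm u * R"
    by (simp add: f_def flex_coeff.simps)
  have step: "f k \<le> M / 2 * (\<Sum>i = 1..<k. f i * f (k - i))" if "2 \<le> k" for k
  proof -
    have "norm (flex_coeff h p u k)
        \<le> 1/2 * (\<Sum>i = 1..<k. norm (h (flex_coeff h p u i) (flex_coeff h p u (k - i))))"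
      using that by (subst flex_coeff.simps) (auto intro: norm_sum)
    also have "\<dots> \<le> 1/2 * (\<Sum>i = 1..<k. M * norm (flex_coeff h p u i) * norm (flex_coeff h p u (k - i)))"
      by (intro mult_left_mono sum_mono h) auto
    finally have "f k \<le> 1/2 * (\<Sum>i = 1..<k. M * norm (flex_coeff h p u i) * norm (flex_coeff h p u (k - i))) * R ^ k"
      unfolding f_def using R by (intro mult_right_mono) auto
    also have "\<dots> = 1/2 * (\<Sum>i = 1..<k. M * norm (flex_coeff h p u i) * norm (flex_coeff h p u (k - i)) * R ^ k)"
      by (simp add: sum_distrib_right)
    also have "(\<Sum>i = 1..<k. M * norm (flex_coeff h p u i) * norm (flex_coeff h p u (k - i)) * R ^ k)
        = (\<Sum>i = 1..<k. M * (f i * f (k - i)))"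
    proof (rule sum.cong[OF refl])
      fix i
      assume "i \<in> {1..<k}"
      then have "R ^ k = R ^ i * R ^ (k - i)"
        by (simp flip: power_add)
      then show "M * norm (flex_coeff h p u i) * norm (flex_coeff h p u (k - i)) * R ^ k = M * (f i * f (k - i))"
        by (simp add: f_def)
    qed
    finally show ?thesis
      by (simp add: sum_distrib_left mult.commute)
  qed
  have bound: "(\<Sum>k = 1..n. f k) \<le> 2 * f 1" for n
  proof (induction n)
    case 0
    then show ?case using f0[of 1] by simp
  next
    case (Suc n)
    have "(\<Sum>k = 1..Suc n. f k) = f 1 + (\<Sum>k = 2..Suc n. f k)"
      by (simp add: sum.atLeast_Suc_atMost numeral_2_eq_2)
    also have "(\<Sum>k = 2..Suc n. f k) \<le> (\<Sum>k = 2..Suc n. M / 2 * (\<Sum>i = 1..<k. f i * f (k - i)))"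
      by (intro sum_mono step) auto
    also have "\<dots> = M / 2 * (\<Sum>k = 2..Suc n. \<Sum>i = 1..<k. f i * f (k - i))"
      by (simp only: sum_distrib_left)
    also have "\<dots> \<le> M / 2 * (\<Sum>k = 1..n. f k)\<^sup>2"
      using M by (intro mult_left_mono convolution_sum_le f0) auto
    also have "\<dots> \<le> M / 2 * (2 * f 1)\<^sup>2"
      using M by (intro mult_left_mono power_mono Suc sum_nonneg f0) auto
    also have "\<dots> = (2 * M * norm u * R) * f 1"
      by (simp add: f1[simplified] power2_eq_square)
    also have "\<dots> \<le> 1 * f 1"
      by (intro mult_right_mono R f0)
    finally show ?case by simp
  qed
  have "summable f"
  proof (rule summableI_nonneg_bounded[OF f0])
    fix n
    have "sum f {..<n} \<le> sum f {0..n}"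
      by (intro sum_mono2 f0) auto
    also have "\<dots> = f 0 + (\<Sum>k = 1..n. f k)"
      by (simp add: sum.atLeast_Suc_atMost)
    also have "\<dots> \<le> f 0 + 2 * f 1"
      using bound by simp
    finally show "sum f {..<n} \<le> f 0 + 2 * f 1" .
  qed
  then show ?thesis
    by (simp add: f_def[abs_def])
qed

lemma flex_coeff_mem:
  assumes U: "subspace U" and "p \<in> U" "u \<in> U" and h: "\<And>x y. h x y \<in> U"
  shows "flex_coeff h p u k \<in> U"
  using assms by (subst flex_coeff.simps) (auto intro!: subspace_neg subspace_scale subspace_sum)

lemma power_series_mem:
  fixes a :: "nat \<Rightarrow> 'a::euclidean_space"
  assumes U: "subspace U" and a: "\<And>k. a k \<in> U"
    and "summable (\<lambda>k. norm (a k) * R ^ k)" and "\<bar>t\<bar> \<le> R"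
  shows "power_series a t \<in> U"
proof -
  have "(\<lambda>n. \<Sum>k<n. t ^ k *\<^sub>R a k) \<longlonglongrightarrow> power_series a t"
    using power_series_sums[OF assms(3,4)] by (simp add: sums_def)
  then show ?thesis
    by (rule closed_sequentially[OF closed_subspace[OF U], rotated])
      (intro subspace_sum subspace_scale U a)
qed

lemma flex_coeff_constant:
  fixes h :: "'a::euclidean_space \<Rightarrow> 'a \<Rightarrow> 'a"
  assumes h: "bilinear h" and sym: "\<And>x y. h x y = h y x" and p: "\<And>x y. h p (h x y) = h x y"
    and u: "h p u = 0" and sm: "summable (\<lambda>k. norm (flex_coeff h p u k) * R ^ k)" and t: "\<bar>t\<bar> \<le> R"
  shows "h (power_series (flex_coeff h p u) t) (power_series (flex_coeff h p u) t) = h p p"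
proof -
  let ?a = "flex_coeff h p u"
  have a0: "?a 0 = p" and a1: "?a 1 = u"
    by (simp_all add: flex_coeff.simps)
  define c where "c k = (\<Sum>i\<le>k. h (t ^ i *\<^sub>R ?a i) (t ^ (k - i) *\<^sub>R ?a (k - i)))" for k
  have "c sums h (power_series ?a t) (power_series ?a t)"
    unfolding c_def[abs_def] power_series_def
    by (intro bilinear_Cauchy_product_sums h power_series_summable_norm[OF sm t])
  moreover have "c k = (if k = 0 then h p p else 0)" for k
  proof -
    consider "k = 0" | "k = 1" | "2 \<le> k" by linarith
    then show ?thesis
    proof cases
      case 3
      have "c k = t ^ k *\<^sub>R (\<Sum>i\<le>k. h (?a i) (?a (k - i)))"
        unfolding c_def scaleR_sum_right
        by (rule sum.cong[OF refl])
          (simp add: bilinear_lmul[OF h] bilinear_rmul[OF h] flip: power_add)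
      also have "{..k} = insert 0 (insert k {1..<k})"
        using 3 by auto
      also have "(\<Sum>i\<in>insert 0 (insert k {1..<k}). h (?a i) (?a (k - i)))
          = 2 *\<^sub>R h p (?a k) + (\<Sum>i = 1..<k. h (?a i) (?a (k - i)))"
        using 3 by (simp add: a0 sym[of "?a k" p] scaleR_2)
      also have "h p (?a k) = ?a k"
      proof -
        have "h p (?a k) = - (1/2) *\<^sub>R (\<Sum>i = 1..<k. h p (h (?a i) (?a (k - i))))"
          using 3 unfolding flex_coeff.simps[of h p u k]
          by (simp add: bilinear_rmul[OF h] bilinear_rneg[OF h] linear_sum[OF h[unfolded bilinear_def, THEN conjunct1, rule_format]])
        also have "\<dots> = ?a k"
          using 3 by (simp add: p flex_coeff.simps[of h p u k])
        finally show ?thesis .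
      qed
      also have "2 *\<^sub>R ?a k = - (\<Sum>i = 1..<k. h (?a i) (?a (k - i)))"
        using 3 by (subst flex_coeff.simps) simp
      finally show ?thesis
        using 3 by simp
    qed (use a0 a1 u in \<open>auto simp: c_def sym[of u p] bilinear_lmul[OF h] bilinear_rmul[OF h]\<close>)
  qed
  ultimately have "(\<lambda>k. if k = 0 then h p p else 0) sums h (power_series ?a t) (power_series ?a t)"
    by (simp add: sums_def)
  then show ?thesis
    using sums_single[of 0 "\<lambda>_. h p p"] sums_unique2 by (simp add: sums_iff) 
qed

text \<open>
  If the space of infinitesimal motions does not become smaller near \<open>p\<close>, every infinitesimal
  motion at \<open>p\<close> is the initial velocity of an analytic motion.

  Let \<open>C\<close> be the orthogonal complement of the kernel in \<open>U\<close>. The map \<open>B p\<close> is injective on \<open>C\<close>;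
  with a left inverse \<open>g\<close> of it, \<open>h = g \<circ> B\<close> meets the conditions for the power series
  above, so there is an analytic \<open>y\<close> with \<open>h y y\<close> constant, that is \<open>h y y' = 0\<close>. Near \<open>p\<close> the kernel
  of \<open>h x\<close> on \<open>U\<close> has at most the dimension of the kernel at \<open>p\<close>, while it contains the kernel of
  \<open>B x\<close>; by the hypothesis on dimensions they coincide. So \<open>B y y' = 0\<close>, and \<open>B y y\<close> is constant.
\<close>

lemma symmetric_form_flex:
  fixes B :: "'a::euclidean_space \<Rightarrow> 'a \<Rightarrow> 'b::euclidean_space"
  assumes B: "bilinear B" and sym: "\<And>x y. B x y = B y x" and U: "subspace U" and p: "p \<in> U"
    and u: "u \<in> form_kernel U B p" and e: "0 < e"
    and dim: "\<And>x. x \<in> U \<Longrightarrow> dist x p < e \<Longrightarrow> dim (form_kernel U B p) \<le> dim (form_kernel U B x)"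
  obtains y r where "0 < r" and "y 0 = p" and "(y has_vector_derivative u) (at 0)"
    and "\<And>t. \<bar>t\<bar> < r \<Longrightarrow> y t \<in> U \<and> B (y t) (y t) = B p p"
    and "\<And>s. 0 < s \<Longrightarrow> s < r \<Longrightarrow> analytic_path_on {0..1} (\<lambda>t. y (s * t))"
proof -
  let ?K = "form_kernel U B"
  have K: "subspace (?K x)" "?K x \<subseteq> U" for x
    using subspace_form_kernel[OF U B] by (auto simp: form_kernel_def)
  have lin: "linear (B x)" for x
    using B by (simp add: bilinear_def)
  define C where "C = {v \<in> U. \<forall>x\<in>?K p. orthogonal x v}"
  have C: "subspace C" "C \<subseteq> U"
    using U by (auto simp: C_def subspace_def orthogonal_clauses)
  have dimC: "dim C + dim (?K p) = dim U"
    unfolding C_def by (rule dim_subspace_orthogonal_to_vectors[OF K(1) U K(2)])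
  have spanC: "span C = C"
    using C by simp
  have "inj_on (B p) (span C)"
  proof (rule linear_injective_on_subspace_0[OF lin subspace_span, THEN iffD2], intro ballI impI)
    fix v
    assume "v \<in> span C" "B p v = 0"
    then have "orthogonal v v"
      unfolding spanC by (auto simp: C_def form_kernel_def)
    then show "v = 0"
      by (simp add: orthogonal_def)
  qed
  then obtain g where g: "range g \<subseteq> C" "linear g" "\<And>v. v \<in> C \<Longrightarrow> g (B p v) = v"
    using linear_inj_on_left_inverse[OF lin, of p C] unfolding spanC by auto
  define h where "h x y = g (B x y)" for x y
  have h: "bilinear h"
    using linear_compose[OF _ g(2), of "\<lambda>x. B x y" for y] linear_compose[OF _ g(2), of "B x" for x] B
    by (simp add: h_def[abs_def] bilinear_def o_def)
  have hC: "h x y \<in> C" for x y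
    using g(1) by (auto simp: h_def)
  have hsym: "h x y = h y x" for x y
    by (simp add: h_def sym)
  have hp: "h p v = v" if "v \<in> C" for v
    using g(3) that by (simp add: h_def)
  have hu: "h p u = 0"
    using u linear_0[OF g(2)] by (simp add: h_def form_kernel_def)
  obtain M where M: "0 < M" "\<And>x y. norm (h x y) \<le> M * norm x * norm y"
    using bilinear_bounded_pos[OF h] by blast
  \<comment> \<open>The summand 1 only avoids a case distinction for \<open>u = 0\<close>.\<close>
  define R where "R = 1 / (2 * M * (norm u + 1))"
  have R: "0 < R" "2 * M * norm u * R \<le> 1"
    using M(1) by (auto simp: R_def field_simps add_pos_nonneg)
  define a where "a = flex_coeff h p u"
  have sm: "summable (\<lambda>k. norm (a k) * R ^ k)"
    unfolding a_def using M R by (intro flex_coeff_summable) auto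
  have aU: "a k \<in> U" for k
    unfolding a_def using p u hC C(2) by (intro flex_coeff_mem U) (auto simp: form_kernel_def)
  define y where "y = power_series a"
  define y' where "y' = power_series (\<lambda>k. real (Suc k) *\<^sub>R a (Suc k))"
  have a01: "a 0 = p" "a 1 = u"
    by (simp_all add: a_def flex_coeff.simps)
  have y0: "y 0 = p" "y' 0 = u"
    using a01 by (simp_all add: y_def y'_def)
  have dy: "(y has_vector_derivative y' t) (at t)" if "\<bar>t\<bar> < R" for t
    unfolding y_def y'_def using sm that by (rule power_series_has_vector_derivative)
  have yU: "y t \<in> U" if "\<bar>t\<bar> < R" for t
    unfolding y_def using that by (intro power_series_mem[OF U aU sm]) auto
  have near': "\<forall>\<^sub>F s in at t. \<bar>s\<bar> < R" if "\<bar>t\<bar> < R" for t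
  proof (rule eventually_mono)
    show "\<forall>\<^sub>F s in at t. s \<in> {-R<..<R}"
      using that by (intro eventually_at_in_open') auto
  qed auto
  have y'U: "y' t \<in> U" if "\<bar>t\<bar> < R" for t
  proof (rule vector_derivative_in_subspace[OF dy[OF that] U])
    have "\<forall>\<^sub>F s in at t. y s - y t \<in> U"
      using near'[OF that] by eventually_elim (intro subspace_diff U yU that)
    then show "\<exists>\<^sub>F s in at t. y s - y t \<in> U"
      by (intro eventually_frequently) auto
  qed
  have hyy': "h (y t) (y' t) = 0" if t: "\<bar>t\<bar> < R" for t
  proof -
    have const: "h (y s) (y s) = h p p" if "\<bar>s\<bar> < R" for s
      unfolding y_def a_def using that
      by (intro flex_coeff_constant[where R = R, OF h hsym] hp hC hu sm[unfolded a_def]) auto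
    have "((\<lambda>t. h (y t) (y t)) has_vector_derivative h (y t) (y' t) + h (y' t) (y t)) (at t)"
      using dy[OF t] dy[OF t] h unfolding bilinear_conv_bounded_bilinear
      by (intro bounded_bilinear.has_vector_derivative[of h])
    moreover have "\<forall>\<^sub>F s in at t. h (y s) (y s) = h (y t) (y t)"
      using near'[OF t] by eventually_elim (simp add: const t)
    ultimately have "h (y t) (y' t) + h (y' t) (y t) = 0"
      by (intro vector_derivative_eq_zero[of "\<lambda>t. h (y t) (y t)"] eventually_frequently) auto
    then show ?thesis
      by (simp add: hsym[of "y' t" "y t"] flip: scaleR_2)
  qed
  have kernel: "v \<in> ?K x" if x: "x \<in> U" "dist x p < e" "dist x p < 1 / M" and v: "v \<in> U" "h x v = 0" for x v
  proof -
    let ?N = "form_kernel U h x"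
    have N: "subspace ?N" "?N \<subseteq> U"
      using subspace_form_kernel[OF U h] by (auto simp: form_kernel_def)
    \<comment> \<open>On \<open>C\<close> the map \<open>h x\<close> differs from the identity \<open>h p\<close> by an operator of norm less than 1.\<close>
    have "c = 0" if c: "c \<in> C" "h x c = 0" for c
    proof (rule ccontr)
      assume "c \<noteq> 0"
      have "c = h (p - x) c"
        using c hp by (simp add: bilinear_lsub[OF h])
      then have "norm c \<le> M * norm (p - x) * norm c"
        using M(2) by metis
      also have "\<dots> < 1 * norm c"
        using x(3) M(1) \<open>c \<noteq> 0\<close> by (intro mult_strict_right_mono) (auto simp: dist_norm norm_minus_commute field_simps)
      finally show False by simp
    qed
    then have "?N \<inter> C \<subseteq> {0}"
      by (auto simp: form_kernel_def)
    then have "dim (?N \<inter> C) = 0"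
      by (simp only: dim_eq_0)
    then have "dim ?N + dim C = dim {a + b |a b. a \<in> ?N \<and> b \<in> C}"
      using dim_sums_Int[OF N(1) C(1)] by linarith
    also have "\<dots> \<le> dim U"
      using N C U by (intro dim_subset) (auto intro: subspace_add)
    finally have "dim ?N \<le> dim (?K x)"
      using dimC dim[OF x(1,2)] by simp
    moreover have "?K x \<subseteq> ?N"
      using linear_0[OF g(2)] by (auto simp: form_kernel_def h_def)
    ultimately have "?K x = ?N"
      by (intro subspace_dim_equal K N)
    then show ?thesis
      using v by (simp add: form_kernel_def)
  qed
  have "continuous (at 0) y"
    using R by (intro has_vector_derivative_continuous[OF dy]) simp
  then obtain r0 where r0: "0 < r0" "\<And>t. \<bar>t\<bar> < r0 \<Longrightarrow> dist (y t) p < min e (1 / M)"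
    unfolding continuous_at_eps_delta using e M(1) y0
    by (metis dist_norm dist_real_def diff_zero min_less_iff_conj zero_less_divide_1_iff)
  define r where "r = min r0 R"
  have r: "0 < r" "r \<le> R" "r \<le> r0"
    using r0 R by (auto simp: r_def)
  have Byy': "B (y t) (y' t) = 0" if "\<bar>t\<bar> < r" for t
    using kernel[of "y t" "y' t"] yU[of t] y'U[of t] hyy'[of t] r0(2)[of t] r that
    by (auto simp: form_kernel_def)
  have "((\<lambda>t. B (y t) (y t)) has_vector_derivative 0) (at t within {-r<..<r})" if "t \<in> {-r<..<r}" for t
  proof -
    have "((\<lambda>t. B (y t) (y t)) has_vector_derivative B (y t) (y' t) + B (y' t) (y t)) (at t)"
      using dy[of t] dy[of t] B that r unfolding bilinear_conv_bounded_bilinear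
      by (intro bounded_bilinear.has_vector_derivative[of B]) auto
    then show ?thesis
      using Byy'[of t] that by (simp add: sym[of "y' t" "y t"] abs_less_iff has_vector_derivative_at_within)
  qed
  then obtain c where c: "\<And>t. t \<in> {-r<..<r} \<Longrightarrow> B (y t) (y t) = c"
    by (rule has_vector_derivative_zero_constant[rotated]) auto
  have "B (y t) (y t) = B p p" if "\<bar>t\<bar> < r" for t
    using c[of t] c[of 0] that r y0(1) by (auto simp: abs_less_iff)
  then show thesis
    using r y0 dy[of 0] R yU power_series_analytic_path[OF sm]
    by (intro that[of r y]) (auto simp: y_def)
qed

lemma summable_norm_powser_inside:
  fixes a :: "nat \<Rightarrow> 'a::real_normed_vector"
  assumes "summable (\<lambda>k. K ^ k *\<^sub>R a k)" and R: "0 \<le> R" "R < \<bar>K\<bar>"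
  shows "summable (\<lambda>k. norm (a k) * R ^ k)"
proof -
  obtain M where M: "\<And>k. norm (K ^ k *\<^sub>R a k) \<le> M"
    using summable_imp_Bseq[OF assms(1)] by (auto simp: Bseq_def)
  have "K \<noteq> 0"
    using R by auto
  have bound: "norm (norm (a k) * R ^ k) \<le> M * (R / \<bar>K\<bar>) ^ k" for k
  proof -
    have "norm (a k) * R ^ k = norm (K ^ k *\<^sub>R a k) * (R / \<bar>K\<bar>) ^ k"
      using R \<open>K \<noteq> 0\<close> by (simp add: power_abs power_divide)
    also have "\<dots> \<le> M * (R / \<bar>K\<bar>) ^ k"
      using R by (intro mult_right_mono M) auto
    finally show ?thesis
      using R by simp
  qed
  have "summable (\<lambda>k. M * (R / \<bar>K\<bar>) ^ k)"
    using R by (intro summable_mult[OF summable_geometric]) auto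
  then show ?thesis
    by (rule summable_comparison_test'[where N = 0]) (rule bound)
qed

lemma analytic_path_has_vector_derivative:
  fixes y :: "real \<Rightarrow> 'a::euclidean_space"
  assumes y: "analytic_path_on {0..1} y" and t0: "t0 \<in> {0..1}"
  obtains d where "(y has_vector_derivative d) (at t0 within {0..1})"
proof -
  obtain r a where r: "0 < r"
    and a: "\<And>t. t \<in> {0..1} \<Longrightarrow> \<bar>t - t0\<bar> < r \<Longrightarrow> (\<lambda>k. (t - t0) ^ k *\<^sub>R a k) sums y t"
    using y t0 unfolding analytic_path_on_def by blast
  \<comment> \<open>A nonzero step that stays inside \<open>{0..1}\<close>, so that the expansion converges there.\<close>
  define K where "K = (if t0 \<le> 1/2 then min (1/2) (r/2) else - min (1/2) (r/2))"
  have K: "t0 + K \<in> {0..1}" "\<bar>K\<bar> < r" "0 < \<bar>K\<bar>"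
    using t0 r by (auto simp: K_def min_def)
  then have "summable (\<lambda>k. K ^ k *\<^sub>R a k)"
    using a[of "t0 + K"] by (auto simp: sums_iff)
  then have sm: "summable (\<lambda>k. norm (a k) * (\<bar>K\<bar> / 2) ^ k)"
    using K by (intro summable_norm_powser_inside[of K]) auto
  define d where "d = power_series (\<lambda>k. real (Suc k) *\<^sub>R a (Suc k)) 0"
  have "(power_series a has_vector_derivative d) (at (t0 - t0))"
    using power_series_has_vector_derivative[OF sm, of 0] K by (simp add: d_def)
  moreover have "((\<lambda>t. t - t0) has_vector_derivative 1) (at t0)"
    by (auto intro!: derivative_eq_intros)
  ultimately have "(power_series a \<circ> (\<lambda>t. t - t0) has_vector_derivative 1 *\<^sub>R d) (at t0)"
    by (intro vector_diff_chain_at) auto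
  then have "(power_series a \<circ> (\<lambda>t. t - t0) has_vector_derivative d) (at t0 within {0..1})"
    by (simp add: has_vector_derivative_at_within)
  then have "(y has_vector_derivative d) (at t0 within {0..1})"
  proof (rule has_vector_derivative_transform_within[OF _ r t0])
    fix t
    assume "t \<in> {0..1}" "dist t t0 < r"
    then show "(power_series a \<circ> (\<lambda>t. t - t0)) t = y t"
      using a[of t] by (simp add: power_series_def dist_real_def sums_iff)
  qed
  then show thesis
    by (rule that)
qed

text \<open>
  If near the starting point each infinitesimal motion for \<open>B\<close> is one for \<open>B'\<close>, then \<open>B'\<close>
  keeps its initial value for a short positive time along each motion that preserves \<open>B\<close>, because the
  velocity of the motion lies in the kernel of \<open>B\<close> at every instant.
\<close>

lemma analytic_motion_preserves_form:
  fixes B :: "'a::euclidean_space \<Rightarrow> 'a \<Rightarrow> 'b::euclidean_space"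
    and B' :: "'a \<Rightarrow> 'a \<Rightarrow> 'c::euclidean_space"
  assumes B: "bilinear B" "\<And>x y. B x y = B y x" and B': "bilinear B'" "\<And>x y. B' x y = B' y x"
    and U: "subspace U" and e: "0 < e"
    and ker: "\<And>x. x \<in> U \<Longrightarrow> dist x (y 0) < e \<Longrightarrow> form_kernel U B x \<subseteq> form_kernel U B' x"
    and y: "analytic_path_on {0..1} y" "\<And>t. t \<in> {0..1} \<Longrightarrow> y t \<in> U"
      "\<And>t. t \<in> {0..1} \<Longrightarrow> B (y t) (y t) = B (y 0) (y 0)"
  shows "\<exists>t\<in>{0<..1}. B' (y t) (y t) = B' (y 0) (y 0)"
proof -
  have "\<forall>t\<in>{0..1}. \<exists>d. (y has_vector_derivative d) (at t within {0..1})"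
    using analytic_path_has_vector_derivative[OF y(1)] by metis
  then obtain d where d: "\<And>t. t \<in> {0..1} \<Longrightarrow> (y has_vector_derivative d t) (at t within {0..1})"
    by metis
  have deriv: "((\<lambda>t. Q (y t) (y t)) has_vector_derivative 2 *\<^sub>R Q (y t) (d t)) (at t within {0..1})"
    if "bilinear Q" "\<And>x y. Q x y = Q y x" "t \<in> {0..1}" for t and Q :: "'a \<Rightarrow> 'a \<Rightarrow> 'x::euclidean_space"
    using bounded_bilinear.has_vector_derivative[OF that(1)[unfolded bilinear_conv_bounded_bilinear] d[OF that(3)] d[OF that(3)]]
      that(2)[of "d t" "y t"] by (simp add: scaleR_2)
  have nontriv: "at t within {0..1::real} \<noteq> bot" if "t \<in> {0..1}" for t
    using that by (simp add: trivial_limit_within islimpt_Icc)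
  have dK: "d t \<in> form_kernel U B (y t)" if t: "t \<in> {0..1}" for t
  proof -
    have ev: "\<forall>\<^sub>F s in at t within {0..1}. s \<in> {0..1}"
      by (simp add: eventually_at_filter)
    then have "\<forall>\<^sub>F s in at t within {0..1}. y s - y t \<in> U"
      by eventually_elim (intro subspace_diff U y(2) t)
    then have "d t \<in> U"
      by (intro vector_derivative_in_subspace[OF d[OF t] U] eventually_frequently nontriv[OF t])
    moreover have "\<forall>\<^sub>F s in at t within {0..1}. B (y s) (y s) = B (y t) (y t)"
      using ev by eventually_elim (use y(3) t in metis)
    then have "2 *\<^sub>R B (y t) (d t) = 0"
      by (intro vector_derivative_eq_zero[OF deriv[OF B t]] eventually_frequently nontriv[OF t])
    ultimately show ?thesis
      by (simp add: form_kernel_def)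
  qed
  have "continuous (at 0 within {0..1}) y"
    by (rule has_vector_derivative_continuous[OF d]) simp
  then obtain s where s: "0 < s" "\<And>t. t \<in> {0..1} \<Longrightarrow> \<bar>t\<bar> < s \<Longrightarrow> dist (y t) (y 0) < e"
    unfolding continuous_within_eps_delta using e by (auto simp: dist_real_def)
  define u where "u = min 1 (s / 2)"
  have u: "0 < u" "u \<le> 1" "u < s"
    using s by (auto simp: u_def)
  have "((\<lambda>t. B' (y t) (y t)) has_vector_derivative 0) (at t within {0..u})" if "t \<in> {0..u}" for t
  proof -
    have t: "t \<in> {0..1}" "\<bar>t\<bar> < s"
      using that u by auto
    then have "B' (y t) (d t) = 0"
      using ker[OF y(2)[OF t(1)] s(2)[OF t]] dK[OF t(1)] by (auto simp: form_kernel_def)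
    then have "((\<lambda>t. B' (y t) (y t)) has_vector_derivative 0) (at t within {0..1})"
      using deriv[OF B' t(1)] by simp
    then show ?thesis
      using u by (rule_tac has_vector_derivative_within_subset) auto
  qed
  then obtain c where c: "\<And>t. t \<in> {0..u} \<Longrightarrow> B' (y t) (y t) = c"
    by (rule has_vector_derivative_zero_constant[rotated]) auto
  have "B' (y u) (y u) = B' (y 0) (y 0)"
    using u c[of u] c[of 0] by auto
  then show ?thesis
    using u by auto
qed

section \<open>Two facts of linear algebra\<close>

lemma dim_image_plus_kernel:
  fixes f :: "'a::euclidean_space \<Rightarrow> 'b::euclidean_space"
  assumes f: "linear f" and U: "subspace U"
  shows "dim (f ` U) + dim {v \<in> U. f v = 0} = dim U"
proof -
  define K where "K = {v \<in> U. f v = 0}"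
  have K: "subspace K"
    using U by (auto simp: K_def subspace_def linear_add[OF f] linear_cmul[OF f] linear_0[OF f])
  define C where "C = {v \<in> U. \<forall>x\<in>K. orthogonal x v}"
  have C: "subspace C" "C \<subseteq> U"
    using U by (auto simp: C_def subspace_def orthogonal_clauses)
  have spanC: "span C = C"
    using C by simp
  have "inj_on f C"
  proof (rule linear_injective_on_subspace_0[OF f C(1), THEN iffD2], intro ballI impI)
    fix v
    assume "v \<in> C" "f v = 0"
    then have "orthogonal v v"
      by (auto simp: C_def K_def)
    then show "v = 0"
      by (simp add: orthogonal_def)
  qed
  then have "dim (f ` C) = dim C"
    by (intro dim_image_eq f) (simp only: spanC)
  moreover have "f ` C = f ` U"
  proof (intro equalityI subsetI)
    fix w
    assume "w \<in> f ` U"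
    then obtain v where v: "v \<in> U" "w = f v" by auto
    obtain z x where zx: "v = z + x" "z \<in> span K" "\<And>v. v \<in> span K \<Longrightarrow> orthogonal x v"
      using orthogonal_subspace_decomp_exists[of K v] by metis
    have z: "z \<in> K"
      using zx(2) K by (metis span_eq_iff)
    have "x = v - z"
      using zx(1) by simp
    with z v U have "x \<in> U"
      by (auto simp: K_def intro: subspace_diff)
    with zx(3) have "x \<in> C"
      by (auto simp: C_def span_base orthogonal_commute)
    moreover have "f x = w"
      using z v zx(1) by (auto simp: K_def linear_add[OF f])
    ultimately show "w \<in> f ` C" by auto
  qed (use C in auto)
  moreover have "dim C + dim K = dim U"
    unfolding C_def using K U by (intro dim_subspace_orthogonal_to_vectors) (auto simp: K_def)
  ultimately show ?thesis by (simp add: K_def)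
qed

lemma orthogonal_projection_exists:
  fixes L :: "'a::euclidean_space set"
  assumes L: "subspace L"
  obtains \<pi> where "linear \<pi>" and "\<And>a. \<pi> a \<in> L" and "\<And>a v. v \<in> L \<Longrightarrow> orthogonal (a - \<pi> a) v"
    and "\<And>a z. z \<in> L \<Longrightarrow> (\<And>v. v \<in> L \<Longrightarrow> orthogonal (a - z) v) \<Longrightarrow> \<pi> a = z"
proof -
  have "\<exists>z. z \<in> L \<and> (\<forall>v\<in>L. orthogonal (a - z) v)" for a
  proof -
    obtain z w where "a = z + w" "z \<in> span L" "\<And>v. v \<in> span L \<Longrightarrow> orthogonal w v"
      using orthogonal_subspace_decomp_exists[of L a] by metis
    then show ?thesis
      using L by (auto simp: span_eq_iff[THEN iffD2] intro!: exI[of _ z])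
  qed
  then obtain \<pi> where \<pi>: "\<And>a. \<pi> a \<in> L" "\<And>a v. v \<in> L \<Longrightarrow> orthogonal (a - \<pi> a) v"
    by metis
  have unique: "\<pi> a = z" if "z \<in> L" "\<And>v. v \<in> L \<Longrightarrow> orthogonal (a - z) v" for a z
  proof -
    have "z - \<pi> a \<in> L"
      using that \<pi> L by (intro subspace_diff)
    then have "(z - \<pi> a) \<bullet> (z - \<pi> a) = 0"
      using that(2)[of "z - \<pi> a"] \<pi>(2)[of "z - \<pi> a" a]
      by (simp add: orthogonal_def inner_diff_left)
    then show ?thesis by simp
  qed
  have "linear \<pi>"
  proof (rule linearI)
    show "\<pi> (a + b) = \<pi> a + \<pi> b" for a b
    proof (rule unique)
      show "\<pi> a + \<pi> b \<in> L"
        by (intro subspace_add L \<pi>)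
      show "orthogonal (a + b - (\<pi> a + \<pi> b)) v" if "v \<in> L" for v
        using \<pi>(2)[OF that, of a] \<pi>(2)[OF that, of b]
        by (simp add: orthogonal_def inner_diff_left inner_add_left)
    qed
    show "\<pi> (c *\<^sub>R a) = c *\<^sub>R \<pi> a" for c a
    proof (rule unique)
      show "c *\<^sub>R \<pi> a \<in> L"
        by (intro subspace_scale L \<pi>)
      show "orthogonal (c *\<^sub>R a - c *\<^sub>R \<pi> a) v" if "v \<in> L" for v
        using \<pi>(2)[OF that, of a] by (simp add: orthogonal_def inner_diff_left)
    qed
  qed
  then show thesis
    using \<pi> unique by (rule that)
qed

section \<open>The edge equations as quadratic forms\<close>

text \<open>
  Half the derivative at \<open>p\<close>, in direction \<open>u\<close>, of the squared edge lengths. The entries are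
  indexed by ordered pairs of vertices and vanish off the edges. On the diagonal \<open>u = p\<close> the entries
  are the squared edge lengths themselves.
\<close>

definition euclidean_form :: "'n::finite set set \<Rightarrow> real^'d^'n \<Rightarrow> real^'d^'n \<Rightarrow> real^'n^'n" where
  "euclidean_form E p u = (\<chi> i j. if {i, j} \<in> E then (p $ i - p $ j) \<bullet> (u $ i - u $ j) else 0)"

text \<open>
  The bilinear form that belongs to \<open>minkowski_sq\<close>.
\<close>

definition minkowski_inner :: "(real^'d) \<times> real \<Rightarrow> (real^'d) \<times> real \<Rightarrow> real" where
  "minkowski_inner a b = fst a \<bullet> fst b - snd a * snd b"

text \<open>
  The corresponding form for the Minkowski products of adjacent vertices and, on the diagonal, of
  each vertex with itself. The diagonal entries encode that the vertices stay on the hyperboloid,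
  where Minkowski distances and Minkowski products determine each other.
\<close>

definition hyperbolic_form ::
    "'n::finite set set \<Rightarrow> ((real^'d) \<times> real)^'n \<Rightarrow> ((real^'d) \<times> real)^'n \<Rightarrow> real^'n^'n" where
  "hyperbolic_form E q v =
    (\<chi> i j. if i = j \<or> {i, j} \<in> E then minkowski_inner (q $ i) (v $ j) + minkowski_inner (q $ j) (v $ i) else 0)"

lemma bilinear_euclidean_form: "bilinear (euclidean_form E)"
  unfolding bilinear_def linear_iff euclidean_form_def
  by (auto simp: vec_eq_iff algebra_simps)

lemma euclidean_form_commute: "euclidean_form E p u = euclidean_form E u p"
  by (auto simp: euclidean_form_def vec_eq_iff inner_commute)

lemma minkowski_inner_commute: "minkowski_inner a b = minkowski_inner b a"
  by (simp add: minkowski_inner_def inner_commute mult.commute)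

lemma bilinear_hyperbolic_form: "bilinear (hyperbolic_form E)"
  unfolding bilinear_def linear_iff hyperbolic_form_def minkowski_inner_def
  by (auto simp: vec_eq_iff algebra_simps)

lemma hyperbolic_form_commute: "hyperbolic_form E q v = hyperbolic_form E v q"
  by (auto simp: hyperbolic_form_def vec_eq_iff minkowski_inner_commute add.commute)

lemma simple_complete_graph: "simple_graph complete_graph"
  by (simp add: simple_graph_def complete_graph_def)

lemma edge_function_eq_iff:
  assumes "simple_graph E"
  shows "edge_function E x = edge_function E p \<longleftrightarrow> euclidean_form E x x = euclidean_form E p p"
proof
  assume eq: "edge_function E x = edge_function E p"
  have "(norm (x $ i - x $ j))\<^sup>2 = (norm (p $ i - p $ j))\<^sup>2" if "{i, j} \<in> E" for i j
    using arg_cong[OF eq, of "\<lambda>f. f $ {i, j}"] that by (simp add: edge_function_edge)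
  then show "euclidean_form E x x = euclidean_form E p p"
    by (auto simp: euclidean_form_def vec_eq_iff power2_norm_eq_inner)
next
  assume eq: "euclidean_form E x x = euclidean_form E p p"
  have *: "(norm (x $ i - x $ j))\<^sup>2 = (norm (p $ i - p $ j))\<^sup>2" if "{i, j} \<in> E" for i j
    using arg_cong[OF eq, of "\<lambda>f. f $ i $ j"] that
    by (simp add: euclidean_form_def power2_norm_eq_inner)
  show "edge_function E x = edge_function E p"
  proof (rule vec_eq_iff[THEN iffD2], rule allI)
    fix e
    show "edge_function E x $ e = edge_function E p $ e"
    proof (cases "e \<in> E")
      case True
      then obtain i j where "e = {i, j}"
        using assms by (auto simp: simple_graph_def card_2_iff)
      with True * show ?thesis
        by (simp add: edge_function_edge)
    qed (simp add: edge_function_def)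
  qed
qed

lemma euclidean_form_complete_eq_0_iff:
  "euclidean_form complete_graph p u = 0 \<longleftrightarrow> (\<forall>i j. (p $ i - p $ j) \<bullet> (u $ i - u $ j) = 0)"
proof -
  have "euclidean_form complete_graph p u $ i $ j = (p $ i - p $ j) \<bullet> (u $ i - u $ j)" for i j
    by (cases "i = j") (auto simp: euclidean_form_def complete_graph_def)
  then show ?thesis
    by (simp add: vec_eq_iff)
qed

section \<open>Symmetric configurations\<close>

text \<open>
  The analogue of \<open>symmetric_configurations\<close> in Minkowski space. The vertices are not required to
  lie on the hyperboloid, so that this is a linear space.
\<close>

definition symmetric_minkowski_configurations :: "(real^'d \<Rightarrow> real^'d) set \<Rightarrow>
    ((real^'d \<Rightarrow> real^'d) \<Rightarrow> 'n::finite \<Rightarrow> 'n) \<Rightarrow> (((real^'d) \<times> real)^'n) set" where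
  "symmetric_minkowski_configurations S \<Phi> = {q. \<forall>x\<in>S. \<forall>i. star x (q $ i) = q $ \<Phi> x i}"

lemma subspace_symmetric_configurations:
  assumes "\<And>x. x \<in> S \<Longrightarrow> linear x"
  shows "subspace (symmetric_configurations S \<Phi>)"
  using assms
  by (auto simp: subspace_def symmetric_configurations_def linear_0 linear_add linear_cmul)

lemma symmetric_minkowski_configurations_iff:
  "q \<in> symmetric_minkowski_configurations S \<Phi> \<longleftrightarrow>
    (\<forall>x\<in>S. \<forall>i. fst (q $ \<Phi> x i) = x (fst (q $ i)) \<and> snd (q $ \<Phi> x i) = snd (q $ i))"
  unfolding symmetric_minkowski_configurations_def star_def split_def prod_eq_iff by auto

lemma subspace_symmetric_minkowski_configurations:
  assumes "\<And>x. x \<in> S \<Longrightarrow> linear x"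
  shows "subspace (symmetric_minkowski_configurations S \<Phi>)"
  using assms
  by (auto simp: subspace_def symmetric_minkowski_configurations_iff linear_0 linear_add linear_cmul)

section \<open>Central projection of infinitesimal motions\<close>

text \<open>
  The projection of each vertex from the origin to the affine hyperplane with last coordinate 1.
\<close>

definition central_projection :: "((real^'d) \<times> real)^'n \<Rightarrow> real^'d^'n::finite" where
  "central_projection q = (\<chi> i. inverse (snd (q $ i)) *\<^sub>R fst (q $ i))"

text \<open>
  Transport of velocities from \<open>central_projection q\<close> to \<open>q\<close>. With \<open>q\<^sub>i = \<alpha>\<^sub>i (p\<^sub>i, 1)\<close> the velocity
  \<open>u\<^sub>i\<close> goes to \<open>\<alpha>\<^sub>i (u\<^sub>i, p\<^sub>i \<bullet> u\<^sub>i)\<close>; the last coordinate makes the image Minkowski-orthogonal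
  to \<open>q\<^sub>i\<close>, hence tangent to the hyperboloid if \<open>q\<^sub>i\<close> lies on it.
\<close>

definition velocity_lift :: "((real^'d) \<times> real)^'n \<Rightarrow> real^'d^'n \<Rightarrow> ((real^'d) \<times> real)^'n::finite" where
  "velocity_lift q u = (\<chi> i. (snd (q $ i) *\<^sub>R u $ i, fst (q $ i) \<bullet> u $ i))"

lemma linear_velocity_lift: "linear (velocity_lift q)"
  unfolding linear_iff velocity_lift_def by (auto simp: vec_eq_iff algebra_simps)

text \<open>
  The identity behind the transfer: under \<open>velocity_lift\<close> the linearised edge equation is only
  multiplied by minus the product of the last coordinates of \<open>q\<^sub>i\<close> and \<open>q\<^sub>j\<close>.
\<close>

lemma minkowski_inner_velocity_lift:
  assumes "\<And>i. snd (q $ i) \<noteq> 0"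
  shows "minkowski_inner (q $ i) (velocity_lift q u $ j) + minkowski_inner (q $ j) (velocity_lift q u $ i)
    = - (snd (q $ i) * snd (q $ j))
      * ((central_projection q $ i - central_projection q $ j) \<bullet> (u $ i - u $ j))"
proof -
  have fst: "fst (q $ i) = snd (q $ i) *\<^sub>R central_projection q $ i" for i
    using assms by (simp add: central_projection_def)
  show ?thesis
    unfolding minkowski_inner_def velocity_lift_def
    by (simp add: fst[of i] fst[of j] algebra_simps)
qed

lemma central_projection_mem:
  assumes "q \<in> symmetric_minkowski_configurations S \<Phi>" and "\<And>x. x \<in> S \<Longrightarrow> linear x"
  shows "central_projection q \<in> symmetric_configurations S \<Phi>"
  unfolding symmetric_configurations_def
proof (intro CollectI ballI allI)
  fix x i
  assume "x \<in> S"
  then show "x (central_projection q $ i) = central_projection q $ \<Phi> x i"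
    using assms(1)
    by (simp add: central_projection_def symmetric_minkowski_configurations_iff linear_cmul assms(2))
qed

text \<open>
  Lifting identifies the symmetric infinitesimal motions of the Euclidean framework with those of
  the framework over it in Minkowski space. The graph is arbitrary, so the same holds
  for the complete graph.
\<close>

lemma velocity_lift_image_kernel:
  assumes q: "q \<in> symmetric_minkowski_configurations S \<Phi>" and q0: "\<And>i. snd (q $ i) \<noteq> 0"
    and S: "\<And>x. x \<in> S \<Longrightarrow> orthogonal_transformation x"
  shows "velocity_lift q ` form_kernel (symmetric_configurations S \<Phi>) (euclidean_form E) (central_projection q)
    = form_kernel (symmetric_minkowski_configurations S \<Phi>) (hyperbolic_form E) q" (is "?l = ?r")
proof (intro equalityI subsetI)
  have qx: "fst (q $ \<Phi> x i) = x (fst (q $ i))" "snd (q $ \<Phi> x i) = snd (q $ i)" if "x \<in> S" for x i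
    using q that by (auto simp: symmetric_minkowski_configurations_iff)
  have lin: "linear x" if "x \<in> S" for x
    using S[OF that] by (rule orthogonal_transformation_linear)
  {
    fix v
    assume "v \<in> ?l"
    then obtain u where u: "u \<in> symmetric_configurations S \<Phi>"
      "euclidean_form E (central_projection q) u = 0" and v: "v = velocity_lift q u"
      by (auto simp: form_kernel_def)
    have "v \<in> symmetric_minkowski_configurations S \<Phi>"
      unfolding symmetric_minkowski_configurations_def
    proof (intro CollectI ballI allI)
      fix x i
      assume x: "x \<in> S"
      have ux: "u $ \<Phi> x i = x (u $ i)"
        using u(1) x by (simp add: symmetric_configurations_def)
      show "star x (v $ i) = v $ \<Phi> x i"
        using S[OF x] by (simp add: v velocity_lift_def star_def ux qx[OF x]
            linear_cmul[OF lin[OF x]] orthogonal_transformation_def)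
    qed
    moreover have "hyperbolic_form E q v = 0"
    proof -
      have "(central_projection q $ i - central_projection q $ j) \<bullet> (u $ i - u $ j) = 0"
        if "{i, j} \<in> E" for i j
        using arg_cong[OF u(2), of "\<lambda>f. f $ i $ j"] that by (simp add: euclidean_form_def)
      then show ?thesis
        by (auto simp: v hyperbolic_form_def vec_eq_iff minkowski_inner_velocity_lift[OF q0])
    qed
    ultimately show "v \<in> ?r"
      by (simp add: form_kernel_def)
  next
    fix v
    assume "v \<in> ?r"
    then have v: "v \<in> symmetric_minkowski_configurations S \<Phi>" "hyperbolic_form E q v = 0"
      by (auto simp: form_kernel_def)
    define u where "u = (\<chi> i. inverse (snd (q $ i)) *\<^sub>R fst (v $ i))"
    have snd: "fst (q $ i) \<bullet> fst (v $ i) = snd (q $ i) * snd (v $ i)" for i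
      using arg_cong[OF v(2), of "\<lambda>f. f $ i $ i"] by (simp add: hyperbolic_form_def minkowski_inner_def)
    have lift: "velocity_lift q u = v"
      unfolding velocity_lift_def u_def vec_eq_iff
      by (auto simp: q0 snd prod_eq_iff)
    have "u \<in> symmetric_configurations S \<Phi>"
      unfolding symmetric_configurations_def
    proof (intro CollectI ballI allI)
      fix x i
      assume x: "x \<in> S"
      then show "x (u $ i) = u $ \<Phi> x i"
        using v(1) by (simp add: u_def symmetric_minkowski_configurations_iff linear_cmul[OF lin[OF x]] qx[OF x])
    qed
    moreover have "euclidean_form E (central_projection q) u = 0"
    proof -
      have "(central_projection q $ i - central_projection q $ j) \<bullet> (u $ i - u $ j) = 0"
        if "{i, j} \<in> E" for i j
        using arg_cong[OF v(2), of "\<lambda>f. f $ i $ j"] that minkowski_inner_velocity_lift[OF q0, where i = i and j = j and u = u] q0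
        by (simp add: hyperbolic_form_def lift)
      then show ?thesis
        by (auto simp: euclidean_form_def vec_eq_iff)
    qed
    ultimately show "v \<in> ?l"
      using lift by (force simp: form_kernel_def)
  }
qed

lemma inj_velocity_lift:
  assumes "\<And>i. snd (q $ i) \<noteq> 0"
  shows "inj (velocity_lift q)"
  using assms by (auto simp: inj_def velocity_lift_def vec_eq_iff)

lemma dim_hyperbolic_kernel:
  assumes "q \<in> symmetric_minkowski_configurations S \<Phi>" and "\<And>i. snd (q $ i) \<noteq> 0"
    and "\<And>x. x \<in> S \<Longrightarrow> orthogonal_transformation x"
  shows "dim (form_kernel (symmetric_minkowski_configurations S \<Phi>) (hyperbolic_form E) q)
    = dim (form_kernel (symmetric_configurations S \<Phi>) (euclidean_form E) (central_projection q))"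
proof -
  let ?K = "form_kernel (symmetric_configurations S \<Phi>) (euclidean_form E) (central_projection q)"
  have "inj_on (velocity_lift q) (span ?K)"
    using inj_velocity_lift[OF assms(2)] by (rule inj_on_subset) simp
  then have "dim (velocity_lift q ` ?K) = dim ?K"
    by (rule dim_image_eq[OF linear_velocity_lift])
  then show ?thesis
    by (simp only: velocity_lift_image_kernel[OF assms])
qed

section \<open>Trivial infinitesimal motions\<close>

text \<open>
  A velocity is trivial if it preserves all distances to first order and respects all affine
  dependencies between the points. The second condition excludes velocities that bend the
  configuration out of its affine hull; these preserve distances to first order without coming from
  rigid motions.
\<close>

definition trivial_velocity :: "real^'d^'n::finite \<Rightarrow> real^'d^'n \<Rightarrow> bool" where
  "trivial_velocity p u \<longleftrightarrow> (\<forall>i j. (p $ i - p $ j) \<bullet> (u $ i - u $ j) = 0) \<and>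
    (\<forall>c. (\<Sum>i\<in>UNIV. c i) = 0 \<longrightarrow> (\<Sum>i\<in>UNIV. c i *\<^sub>R p $ i) = 0 \<longrightarrow> (\<Sum>i\<in>UNIV. c i *\<^sub>R u $ i) = 0)"

text \<open>
  The vector field \<open>v \<mapsto> A v + b\<close> generates a one-parameter group of isometries (\<open>A\<close> is skew) and
  commutes with \<open>S\<close>.
\<close>

definition symmetric_killing :: "(real^'d \<Rightarrow> real^'d) set \<Rightarrow> (real^'d \<Rightarrow> real^'d) \<Rightarrow> real^'d \<Rightarrow> bool" where
  "symmetric_killing S A b \<longleftrightarrow> linear A \<and> (\<forall>v w. A v \<bullet> w + v \<bullet> A w = 0) \<and>
    (\<forall>x\<in>S. x b = b \<and> (\<forall>v. x (A v) = A (x v)))"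

lemma linear_extension_by_dependencies:
  fixes e w :: "'n::finite \<Rightarrow> 'a::euclidean_space"
  assumes "\<And>c. (\<Sum>i\<in>UNIV. c i *\<^sub>R e i) = 0 \<Longrightarrow> (\<Sum>i\<in>UNIV. c i *\<^sub>R w i) = 0"
  obtains f where "linear f" and "\<And>i. f (e i) = w i"
proof -
  \<comment> \<open>The kernel of \<open>T e\<close> lies in that of \<open>T w\<close>, so \<open>T w\<close> factors through \<open>T e\<close>.\<close>
  define T where "T d c = (\<Sum>i\<in>UNIV. c $ i *\<^sub>R d i)" for d :: "'n \<Rightarrow> 'a" and c :: "real^'n"
  have T: "linear (T d)" for d
    unfolding T_def linear_iff
    by (simp add: scaleR_add_left sum.distrib scaleR_sum_right)
  have axis: "T d (axis i 1) = d i" for d i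
  proof -
    have "T d (axis i 1) = (\<Sum>j\<in>UNIV. if j = i then d j else 0)"
      unfolding T_def by (rule sum.cong) (auto simp: axis_def)
    then show ?thesis by simp
  qed
  have "span (range (T e)) \<subseteq> T e ` span UNIV"
    by (rule equalityD1[OF linear_span_image[OF T]])
  from linear_surj_right_inverse[OF T this]
  obtain g where g: "linear g" "\<And>v. v \<in> span (range (T e)) \<Longrightarrow> T e (g v) = v"
    by blast
  have "T w (g (e i)) = w i" for i
  proof -
    have "T e (axis i 1) \<in> span (range (T e))"
      by (intro span_base) auto
    then have "T e (g (e i)) = T e (axis i 1)"
      using g(2) axis by simp
    then have "T e (g (e i) - axis i 1) = 0"
      by (simp add: linear_diff[OF T])
    then have "T w (g (e i) - axis i 1) = 0"
      using assms unfolding T_def by blast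
    then show ?thesis
      by (simp add: linear_diff[OF T] axis)
  qed
  then show thesis
    using linear_compose[OF g(1) T] by (intro that[of "T w \<circ> g"]) auto
qed

text \<open>
  A symmetric trivial velocity is the restriction of such a field. Let \<open>L\<close> be the direction space
  of the affine hull of \<open>p\<close>, \<open>\<pi>\<close> the orthogonal projection to \<open>L\<close>, and \<open>f\<close> linear with
  \<open>f (p\<^sub>i - p\<^sub>j) = u\<^sub>i - u\<^sub>j\<close>. On \<open>L\<close> the map \<open>f\<close> is skew. With \<open>F = f \<circ> \<pi>\<close> the field \<open>A = F - F\<^sup>* (1 - \<pi>)\<close>
  is skew on the whole space and agrees with \<open>f\<close> on \<open>L\<close>. Since \<open>S\<close> preserves \<open>L\<close>, all of these
  commute with \<open>S\<close>; no averaging over \<open>S\<close> is needed.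
\<close>

lemma trivial_velocity_killing:
  fixes p u :: "real^'d^'n::finite"
  assumes S: "\<And>x. x \<in> S \<Longrightarrow> orthogonal_transformation x" and \<Phi>: "\<And>x. x \<in> S \<Longrightarrow> bij (\<Phi> x)"
    and p: "p \<in> symmetric_configurations S \<Phi>" and u: "u \<in> symmetric_configurations S \<Phi>"
    and triv: "trivial_velocity p u"
  obtains A b where "symmetric_killing S A b" and "\<And>i. u $ i = A (p $ i) + b"
proof -
  obtain k :: 'n where True by simp
  define e where "e i = p $ i - p $ k" for i
  define w where "w i = u $ i - u $ k" for i
  have px: "x (p $ i) = p $ \<Phi> x i" and ux: "x (u $ i) = u $ \<Phi> x i" if "x \<in> S" for x i
    using p u that by (auto simp: symmetric_configurations_def)
  have lin: "linear x" if "x \<in> S" for x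
    using S[OF that] by (rule orthogonal_transformation_linear)
  have isom: "x v \<bullet> x v' = v \<bullet> v'" if "x \<in> S" for x v v'
    using S[OF that] by (simp add: orthogonal_transformation_def)
  have "(\<Sum>i\<in>UNIV. c i *\<^sub>R w i) = 0" if c: "(\<Sum>i\<in>UNIV. c i *\<^sub>R e i) = 0" for c
  proof -
    \<comment> \<open>The dependency between the differences is an affine dependency between the points.\<close>
    define c' where "c' i = c i - (if i = k then sum c UNIV else 0)" for i
    have eq: "(\<Sum>i\<in>UNIV. c' i *\<^sub>R r $ i) = (\<Sum>i\<in>UNIV. c i *\<^sub>R (r $ i - r $ k))" for r :: "real^'d^'n"
      by (simp add: c'_def scaleR_diff_left scaleR_diff_right sum_subtractf if_distrib[of "\<lambda>a. a *\<^sub>R _"]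
          cong: if_cong flip: scaleR_sum_left)
    have "sum c' UNIV = 0"
      by (simp add: c'_def sum_subtractf)
    moreover have "(\<Sum>i\<in>UNIV. c' i *\<^sub>R p $ i) = 0"
      using c unfolding eq e_def .
    ultimately show ?thesis
      using triv unfolding trivial_velocity_def w_def eq[symmetric] by blast
  qed
  then obtain f where f: "linear f" "\<And>i. f (e i) = w i"
    using linear_extension_by_dependencies[of e w] by metis
  define L where "L = span (range e)"
  have L: "subspace L" and eL: "e i \<in> L" for i
    by (auto simp: L_def intro: span_base)
  obtain \<pi> where \<pi>: "linear \<pi>" "\<And>a. \<pi> a \<in> L" "\<And>a v. v \<in> L \<Longrightarrow> orthogonal (a - \<pi> a) v"
    "\<And>a z. z \<in> L \<Longrightarrow> (\<And>v. v \<in> L \<Longrightarrow> orthogonal (a - z) v) \<Longrightarrow> \<pi> a = z"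
    using orthogonal_projection_exists[OF L] by metis
  have \<pi>L: "\<pi> a = a" if "a \<in> L" for a
    using that by (intro \<pi>(4)) (auto simp: orthogonal_def)
  have fdiff: "f (p $ i - p $ j) = u $ i - u $ j" for i j
  proof -
    have "p $ i - p $ j = e i - e j" by (simp add: e_def)
    then show ?thesis
      by (simp add: linear_diff[OF f(1)] f(2) w_def)
  qed
  have diffL: "p $ i - p $ j \<in> L" for i j
  proof -
    have "e i - e j \<in> L"
      by (intro subspace_diff L eL)
    then show ?thesis by (simp add: e_def)
  qed
  have skew_e: "w i \<bullet> e j + e i \<bullet> w j = 0" for i j
  proof -
    have t: "(p $ i - p $ j) \<bullet> (u $ i - u $ j) = 0" for i j
      using triv by (simp add: trivial_velocity_def)
    have "(e i - e j) \<bullet> (w i - w j) = 0" "e i \<bullet> w i = 0" "e j \<bullet> w j = 0"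
      using t[of i j] t[of i k] t[of j k] by (simp_all add: e_def w_def)
    then show ?thesis
      by (simp add: inner_diff_left inner_diff_right inner_commute)
  qed
  have skew: "f a \<bullet> b + a \<bullet> f b = 0" if "a \<in> L" "b \<in> L" for a b
  proof -
    let ?h = "\<lambda>a b. f a \<bullet> b + a \<bullet> f b"
    have "bilinear ?h" "bilinear (\<lambda>a b. 0 :: real)"
      unfolding bilinear_def linear_iff
      by (simp_all add: linear_add[OF f(1)] linear_cmul[OF f(1)] algebra_simps)
    moreover have "\<forall>a\<in>range e. \<forall>b\<in>range e. ?h a b = 0"
      using skew_e f(2) by auto
    ultimately show ?thesis
      using bilinear_eq[of ?h "\<lambda>a b. 0" L "range e" L "range e" a b] that unfolding L_def by blast
  qed
  have xe: "x (e i) = p $ \<Phi> x i - p $ \<Phi> x k" if "x \<in> S" for x i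
    by (simp add: e_def linear_diff[OF lin[OF that]] px[OF that])
  have xL: "x a \<in> L" if "x \<in> S" "a \<in> L" for x a
  proof -
    have "x ` span (range e) = span (x ` range e)"
      using linear_span_image[OF lin[OF that(1)]] by metis
    also have "\<dots> \<subseteq> L"
      using xe[OF that(1)] diffL by (intro span_minimal L) auto
    finally show ?thesis
      using that(2) by (auto simp: L_def)
  qed
  have Lx: "\<exists>a'\<in>L. x a' = a" if "x \<in> S" "a \<in> L" for x a
  proof -
    have "e i \<in> x ` L" for i
    proof -
      define i' k' where "i' = inv_into UNIV (\<Phi> x) i" and "k' = inv_into UNIV (\<Phi> x) k"
      have "\<Phi> x i' = i" "\<Phi> x k' = k"
        using \<Phi>[OF that(1)] by (simp_all add: i'_def k'_def bij_is_surj surj_f_inv_f)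
      then have "x (p $ i' - p $ k') = e i"
        by (simp add: linear_diff[OF lin[OF that(1)]] px[OF that(1)] e_def)
      then show ?thesis
        using diffL by (metis image_eqI)
    qed
    then have "L \<subseteq> x ` L"
      unfolding L_def by (intro span_minimal linear_subspace_image lin that(1)) (auto simp: L_def)
    then show ?thesis
      using that(2) by blast
  qed
  have x\<pi>: "\<pi> (x a) = x (\<pi> a)" if "x \<in> S" for x a
  proof (rule \<pi>(4))
    show "x (\<pi> a) \<in> L"
      by (rule xL[OF that \<pi>(2)])
    fix v
    assume "v \<in> L"
    then obtain v' where "v' \<in> L" "v = x v'"
      using Lx[OF \<open>x \<in> S\<close>] by metis
    then show "orthogonal (x a - x (\<pi> a)) v"
      using \<pi>(3)[of v' a] by (simp add: orthogonal_def isom[OF that] flip: linear_diff[OF lin[OF that]])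
  qed
  have xf: "x (f a) = f (x a)" if "x \<in> S" "a \<in> L" for x a
  proof (rule linear_eq_on_span[of "\<lambda>a. x (f a)" "\<lambda>a. f (x a)" "range e"])
    show "linear (\<lambda>a. x (f a))" "linear (\<lambda>a. f (x a))"
      using linear_compose[OF f(1) lin[OF that(1)]] linear_compose[OF lin[OF that(1)] f(1)]
      by (simp_all add: o_def)
    show "x (f a) = f (x a)" if "a \<in> range e" for a
      using that xe[OF \<open>x \<in> S\<close>] fdiff
      by (auto simp: f(2) w_def linear_diff[OF lin[OF \<open>x \<in> S\<close>]] ux[OF \<open>x \<in> S\<close>])
  qed (use that in \<open>simp add: L_def\<close>)
  define F where "F a = f (\<pi> a)" for a
  have F: "linear F"
    using linear_compose[OF \<pi>(1) f(1)] by (simp add: F_def[abs_def] o_def)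
  have xF: "x (F a) = F (x a)" if "x \<in> S" for x a
    by (simp add: F_def x\<pi>[OF that] xf[OF that \<pi>(2)])
  have adj: "a \<bullet> adjoint F c = F a \<bullet> c" for a c
    by (rule adjoint_works[OF F])
  have xadj: "x (adjoint F c) = adjoint F (x c)" if "x \<in> S" for x c
  proof (rule vector_eq_ldot[THEN iffD1], rule allI)
    fix z
    obtain y where y: "z = x y"
      using orthogonal_transformation_surj[OF S[OF \<open>x \<in> S\<close>]] by (metis surjD)
    show "z \<bullet> x (adjoint F c) = z \<bullet> adjoint F (x c)"
      by (simp add: y isom[OF that] adj xF[OF that, symmetric])
  qed
  define A where "A a = F a - adjoint F (a - \<pi> a)" for a
  have Alin: "linear A"
    unfolding linear_iff A_def
    by (simp add: linear_add[OF F] linear_add[OF \<pi>(1)] linear_cmul[OF F] linear_cmul[OF \<pi>(1)]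
        linear_diff[OF adjoint_linear[OF F]] linear_add[OF adjoint_linear[OF F]]
        linear_cmul[OF adjoint_linear[OF F]] algebra_simps)
  have Askew: "A a \<bullet> c + a \<bullet> A c = 0" for a c
  proof -
    have "A a \<bullet> c + a \<bullet> A c = F a \<bullet> \<pi> c + \<pi> a \<bullet> F c"
      by (simp add: A_def inner_diff_left inner_diff_right adj inner_commute[of "adjoint F _"]
          inner_commute[of c] inner_commute[of "F c"])
    also have "\<dots> = 0"
      using skew[OF \<pi>(2) \<pi>(2)] by (simp add: F_def)
    finally show ?thesis .
  qed
  have xA: "x (A a) = A (x a)" if "x \<in> S" for x a
    by (simp add: A_def linear_diff[OF lin[OF that]] xF[OF that] xadj[OF that] x\<pi>[OF that])
  define b where "b = u $ k - A (p $ k)"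
  have Au: "u $ i = A (p $ i) + b" for i
  proof -
    have "A (e i) = w i"
      using eL[of i] f(2) \<pi>L[of "e i"] linear_0[OF adjoint_linear[OF F]] by (simp add: A_def F_def)
    then show ?thesis
      by (simp add: b_def e_def w_def linear_diff[OF Alin] algebra_simps)
  qed
  have "x b = b" if "x \<in> S" for x
  proof -
    have "x b = u $ \<Phi> x k - A (p $ \<Phi> x k)"
      by (simp add: b_def linear_diff[OF lin[OF that]] ux[OF that] xA[OF that] px[OF that])
    then show ?thesis
      using Au[of "\<Phi> x k"] by simp
  qed
  then have "symmetric_killing S A b"
    using Alin Askew xA by (simp add: symmetric_killing_def)
  then show thesis
    using Au by (rule that)
qed

lemma killing_velocity_trivial:
  assumes "symmetric_killing S A b"
  shows "euclidean_form complete_graph p (\<chi> i. A (p $ i) + b) = 0"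
  unfolding euclidean_form_complete_eq_0_iff
proof (intro allI)
  fix i j
  have "A (p $ i - p $ j) \<bullet> (p $ i - p $ j) = 0"
  proof -
    have "A (p $ i - p $ j) \<bullet> (p $ i - p $ j) + (p $ i - p $ j) \<bullet> A (p $ i - p $ j) = 0"
      using assms unfolding symmetric_killing_def by blast
    then show ?thesis
      by (simp add: inner_commute)
  qed
  then show "(p $ i - p $ j) \<bullet> ((\<chi> i. A (p $ i) + b) $ i - (\<chi> i. A (p $ i) + b) $ j) = 0"
    using assms by (simp add: symmetric_killing_def linear_diff inner_commute)
qed

text \<open>
  The velocities induced at the configuration \<open>p\<close> by these fields.
\<close>

definition killing_velocities :: "(real^'d \<Rightarrow> real^'d) set \<Rightarrow> real^'d^'n \<Rightarrow> (real^'d^'n::finite) set" where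
  "killing_velocities S p = {(\<chi> i. A (p $ i) + b) |A b. symmetric_killing S A b}"

lemma killing_velocitiesI: "symmetric_killing S A b \<Longrightarrow> (\<chi> i. A (p $ i) + b) \<in> killing_velocities S p"
  by (auto simp: killing_velocities_def)

lemma subspace_killing_velocities:
  fixes x :: "real^'d^'n::finite"
  assumes lin: "\<And>x. x \<in> S \<Longrightarrow> linear x"
  shows "subspace (killing_velocities S x)"
proof -
  have "symmetric_killing S (\<lambda>v. 0) 0"
    using lin by (auto simp: symmetric_killing_def linear_0 linear_iff)
  then have "0 \<in> killing_velocities S x"
    by (force simp: killing_velocities_def vec_eq_iff)
  moreover have "v + w \<in> killing_velocities S x" if vw: "v \<in> killing_velocities S x" "w \<in> killing_velocities S x" for v w
  proof -
    obtain A b A' b' where k: "symmetric_killing S A b" "symmetric_killing S A' b'"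
      and v: "v = (\<chi> i. A (x $ i) + b)" "w = (\<chi> i. A' (x $ i) + b')"
      using vw by (auto simp: killing_velocities_def)
    have "(\<lambda>y. A y + A' y) y \<bullet> z + y \<bullet> (\<lambda>y. A y + A' y) z = 0" for y z
    proof -
      have "A y \<bullet> z + y \<bullet> A z = 0" "A' y \<bullet> z + y \<bullet> A' z = 0"
        using k by (auto simp: symmetric_killing_def)
      then show ?thesis
        by (simp add: inner_add_left inner_add_right)
    qed
    then have "symmetric_killing S (\<lambda>y. A y + A' y) (b + b')"
      using k lin by (auto simp: symmetric_killing_def linear_add linear_compose_add)
    moreover have "v + w = (\<chi> i. (\<lambda>y. A y + A' y) (x $ i) + (b + b'))"
      by (simp add: v vec_eq_iff)
    ultimately show ?thesis
      using killing_velocitiesI[of S "\<lambda>y. A y + A' y" "b + b'" x] by simp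
  qed
  moreover have "c *\<^sub>R v \<in> killing_velocities S x" if v: "v \<in> killing_velocities S x" for c v
  proof -
    obtain A b where k: "symmetric_killing S A b" and v: "v = (\<chi> i. A (x $ i) + b)"
      using v by (auto simp: killing_velocities_def)
    have "(\<lambda>y. c *\<^sub>R A y) y \<bullet> z + y \<bullet> (\<lambda>y. c *\<^sub>R A y) z = 0" for y z
    proof -
      have "A y \<bullet> z + y \<bullet> A z = 0"
        using k by (auto simp: symmetric_killing_def)
      then show ?thesis
        by (simp flip: distrib_left)
    qed
    then have "symmetric_killing S (\<lambda>y. c *\<^sub>R A y) (c *\<^sub>R b)"
      using k lin by (auto simp: symmetric_killing_def linear_cmul linear_compose_scale_right)
    moreover have "c *\<^sub>R v = (\<chi> i. (\<lambda>y. c *\<^sub>R A y) (x $ i) + c *\<^sub>R b)"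
      by (simp add: v vec_eq_iff scaleR_add_right)
    ultimately show ?thesis
      using killing_velocitiesI[of S "\<lambda>y. c *\<^sub>R A y" "c *\<^sub>R b" x] by simp
  qed
  ultimately show ?thesis
    by (simp add: subspace_def)
qed

text \<open>
  Infinitesimal rigidity is inherited by nearby symmetric configurations. Otherwise there are
  configurations tending to \<open>p\<close> with unit infinitesimal motions orthogonal to the velocities of
  all symmetric Killing fields. A limit of these is an infinitesimal motion at \<open>p\<close>, hence the
  velocity of such a field, and orthogonal to itself.
\<close>

lemma rigid_near_rigid:
  fixes p :: "real^'d^'n::finite"
  assumes S: "\<And>x. x \<in> S \<Longrightarrow> orthogonal_transformation x" and \<Phi>: "\<And>x. x \<in> S \<Longrightarrow> bij (\<Phi> x)"
    and p: "p \<in> symmetric_configurations S \<Phi>"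
    and rigid: "\<And>u. u \<in> form_kernel (symmetric_configurations S \<Phi>) (euclidean_form E) p \<Longrightarrow> trivial_velocity p u"
  obtains e where "0 < e"
    and "\<And>x. x \<in> symmetric_configurations S \<Phi> \<Longrightarrow> dist x p < e \<Longrightarrow>
      form_kernel (symmetric_configurations S \<Phi>) (euclidean_form E) x
        \<subseteq> form_kernel (symmetric_configurations S \<Phi>) (euclidean_form complete_graph) x"
proof (rule ccontr)
  let ?P = "symmetric_configurations S \<Phi>"
  let ?K = "form_kernel ?P (euclidean_form E)" and ?T = "form_kernel ?P (euclidean_form complete_graph)"
  assume neg: "\<not> thesis"
  have lin: "linear x" if "x \<in> S" for x
    using S[OF that] by (rule orthogonal_transformation_linear)
  have P: "subspace ?P"
    using lin by (rule subspace_symmetric_configurations)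
  let ?V = "killing_velocities S"
  have TK: "?T x \<subseteq> ?K x" for x
  proof
    fix u
    assume "u \<in> ?T x"
    then have "u \<in> ?P" "\<forall>i j. (x $ i - x $ j) \<bullet> (u $ i - u $ j) = 0"
      unfolding form_kernel_def euclidean_form_complete_eq_0_iff by auto
    then show "u \<in> ?K x"
      by (simp add: form_kernel_def euclidean_form_def vec_eq_iff)
  qed
  have VT: "?V x \<subseteq> ?T x" if x: "x \<in> ?P" for x
  proof
    fix v
    assume "v \<in> ?V x"
    then obtain A b where k: "symmetric_killing S A b" and v: "v = (\<chi> i. A (x $ i) + b)"
      by (auto simp: killing_velocities_def)
    have "v \<in> ?P"
      using k x lin by (auto simp: symmetric_configurations_def v symmetric_killing_def linear_add)
    then show "v \<in> ?T x"
      using killing_velocity_trivial[OF k, of x] by (simp add: form_kernel_def v)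
  qed
  have Ksub: "subspace (?K x)" "subspace (?T x)" for x
    by (intro subspace_form_kernel P bilinear_euclidean_form)+
  have "\<exists>x w. x \<in> ?P \<and> dist x p < inverse (real (Suc n)) \<and> w \<in> ?K x \<and> norm w = 1 \<and> (\<forall>v\<in>?V x. w \<bullet> v = 0)" for n
  proof -
    have "\<not> (\<forall>x. x \<in> ?P \<longrightarrow> dist x p < inverse (real (Suc n)) \<longrightarrow> ?K x \<subseteq> ?T x)"
      using neg that[of "inverse (real (Suc n))"] by auto
    then obtain x u where x: "x \<in> ?P" "dist x p < inverse (real (Suc n))" and u: "u \<in> ?K x" "u \<notin> ?T x"
      by blast
    obtain z w where zw: "u = z + w" "z \<in> span (?V x)" "\<And>v. v \<in> span (?V x) \<Longrightarrow> orthogonal w v"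
      using orthogonal_subspace_decomp_exists[of "?V x" u] by metis
    have z: "z \<in> ?V x"
      using zw(2) subspace_killing_velocities[OF lin] by (metis span_eq_iff)
    then have "z \<in> ?T x"
      using VT[OF x(1)] by blast
    then have "w \<noteq> 0"
      using u(2) zw(1) by auto
    have "u - z \<in> ?K x"
      using \<open>z \<in> ?T x\<close> TK u(1) by (intro subspace_diff Ksub) auto
    then have "w \<in> ?K x"
      using zw(1) by simp
    then have "(1 / norm w) *\<^sub>R w \<in> ?K x"
      by (intro subspace_scale Ksub)
    moreover have "norm ((1 / norm w) *\<^sub>R w) = 1"
      using \<open>w \<noteq> 0\<close> by simp
    moreover have "\<forall>v\<in>?V x. ((1 / norm w) *\<^sub>R w) \<bullet> v = 0"
      using zw(3) by (auto simp: orthogonal_def span_base)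
    ultimately show ?thesis
      using x by blast
  qed
  then obtain x w where xw: "\<And>n. x n \<in> ?P" "\<And>n. dist (x n) p < inverse (real (Suc n))"
    "\<And>n. w n \<in> ?K (x n)" "\<And>n. norm (w n) = 1" "\<And>n v. v \<in> ?V (x n) \<Longrightarrow> w n \<bullet> v = 0"
    by metis
  have "seq_compact (sphere 0 1 :: (real^'d^'n) set)"
    by (simp add: compact_imp_seq_compact)
  then obtain l r where l: "l \<in> sphere 0 1" and r: "strict_mono r" and wl: "(w \<circ> r) \<longlonglongrightarrow> l"
    using xw(4) unfolding seq_compact_def by (metis mem_sphere_0)
  have "(\<lambda>n. dist (x n) p) \<longlonglongrightarrow> 0"
    using xw(2) by (intro LIMSEQ_norm_0) (simp add: inverse_eq_divide)
  then have "x \<longlonglongrightarrow> p"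
    by (rule tendsto_dist_iff[THEN iffD2])
  then have xl: "(x \<circ> r) \<longlonglongrightarrow> p"
    using r by (rule LIMSEQ_subseq_LIMSEQ)
  have "l \<in> ?P"
    using closed_subspace[OF P] _ wl by (rule closed_sequentially) (use xw(3) in \<open>auto simp: form_kernel_def\<close>)
  moreover have "(\<lambda>n. euclidean_form E ((x \<circ> r) n) ((w \<circ> r) n)) \<longlonglongrightarrow> euclidean_form E p l"
    by (rule bounded_bilinear.tendsto[OF bilinear_euclidean_form[unfolded bilinear_conv_bounded_bilinear] xl wl])
  then have "euclidean_form E p l = 0"
    using xw(3) by (simp add: form_kernel_def LIMSEQ_const_iff)
  ultimately have lK: "l \<in> ?K p"
    by (simp add: form_kernel_def)
  then obtain A b where k: "symmetric_killing S A b" and lA: "\<And>i. l $ i = A (p $ i) + b"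
    using trivial_velocity_killing[OF S \<Phi> p \<open>l \<in> ?P\<close> rigid[OF lK]] by metis
  have A: "bounded_linear A"
    using k by (simp add: symmetric_killing_def linear_conv_bounded_linear)
  have "(\<lambda>n. \<Sum>i\<in>UNIV. (w \<circ> r) n $ i \<bullet> (A ((x \<circ> r) n $ i) + b)) \<longlonglongrightarrow> (\<Sum>i\<in>UNIV. l $ i \<bullet> (A (p $ i) + b))"
    by (intro tendsto_sum tendsto_inner tendsto_add tendsto_const tendsto_vec_nth wl xl bounded_linear.tendsto[OF A])
  moreover have "(\<Sum>i\<in>UNIV. (w \<circ> r) n $ i \<bullet> (A ((x \<circ> r) n $ i) + b)) = 0" for n
  proof -
    have "(\<chi> i. A (x (r n) $ i) + b) \<in> ?V (x (r n))"
      using k by (auto simp: killing_velocities_def)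
    from xw(5)[OF this] show ?thesis
      by (simp add: inner_vec_def)
  qed
  ultimately have "(\<Sum>i\<in>UNIV. l $ i \<bullet> (A (p $ i) + b)) = 0"
    by (simp add: LIMSEQ_const_iff)
  then have "l \<bullet> l = 0"
    by (simp add: inner_vec_def lA)
  with l show False
    by simp
qed

section \<open>Regular points\<close>

text \<open>
  The derivative of \<open>edge_function\<close> at \<open>p\<close> in direction \<open>u\<close>.
\<close>

definition edge_derivative :: "'n::finite set set \<Rightarrow> real^'d^'n \<Rightarrow> real^'d^'n \<Rightarrow> real^('n set)" where
  "edge_derivative E p u =
    (\<chi> e. if e \<in> E then (\<Sum>i\<in>e. \<Sum>j\<in>e. (p $ i - p $ j) \<bullet> (u $ i - u $ j)) else 0)"

lemma bilinear_edge_derivative: "bilinear (edge_derivative E)"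
  unfolding bilinear_def linear_iff edge_derivative_def
  by (auto simp: vec_eq_iff algebra_simps sum_distrib_left simp flip: sum.distrib)

lemma edge_function_has_derivative:
  fixes p :: "real^'d^'n::finite"
  shows "(edge_function E has_derivative edge_derivative E p) (at p within X)"
proof -
  have sym: "edge_derivative E u p = edge_derivative E p u" for u
    unfolding edge_derivative_def vec_eq_iff
    by (auto simp: inner_commute[of "u $ _ - u $ _"] intro!: sum.cong)
  have "((\<lambda>p :: real^'d^'n. edge_derivative E p p) has_derivative (\<lambda>u. edge_derivative E p u + edge_derivative E u p))
      (at p within X)"
    by (rule bounded_bilinear.FDERIV[OF bilinear_edge_derivative[unfolded bilinear_conv_bounded_bilinear]])
      (rule has_derivative_ident)+
  then have "((\<lambda>p. (1/2) *\<^sub>R edge_derivative E p p) has_derivative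
      (\<lambda>u. (1/2) *\<^sub>R (edge_derivative E p u + edge_derivative E u p))) (at p within X)"
    by (rule has_derivative_scaleR_right)
  moreover have "(\<lambda>p :: real^'d^'n. (1/2) *\<^sub>R edge_derivative E p p) = edge_function E"
    by (auto simp: fun_eq_iff vec_eq_iff edge_derivative_def edge_function_def power2_norm_eq_inner)
  moreover have "(\<lambda>u. (1/2) *\<^sub>R (edge_derivative E p u + edge_derivative E u p)) = edge_derivative E p"
    by (simp add: fun_eq_iff sym flip: scaleR_2)
  ultimately show ?thesis by (simp only:)
qed

text \<open>
  Derivatives within a subspace agree along the subspace, although not off it.
\<close>

lemma frechet_derivative_within_subspace:
  fixes f :: "'a::real_normed_vector \<Rightarrow> 'b::real_normed_vector"
  assumes P: "subspace P" "p \<in> P" "h \<in> P" and D: "(f has_derivative D) (at p within P)"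
  shows "frechet_derivative f (at p within P) h = D h"
proof -
  define \<gamma> where "\<gamma> t = p + t *\<^sub>R h" for t :: real
  have \<gamma>: "(\<gamma> has_derivative (\<lambda>t. t *\<^sub>R h)) (at 0)" "range \<gamma> \<subseteq> P" "\<gamma> 0 = p"
    using P by (auto simp: \<gamma>_def[abs_def] subspace_add subspace_scale intro!: derivative_eq_intros)
  have along: "(f \<circ> \<gamma> has_derivative D' \<circ> (\<lambda>t. t *\<^sub>R h)) (at 0)"
    if "(f has_derivative D') (at p within P)" for D'
    using \<gamma> has_derivative_subset[OF that \<gamma>(2)] by (intro diff_chain_within) auto
  have "(f has_derivative frechet_derivative f (at p within P)) (at p within P)"
    using D by (intro frechet_derivative_works[THEN iffD1] differentiableI)
  from has_derivative_unique[OF along[OF this] along[OF D]]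
  show ?thesis
    by (auto simp: fun_eq_iff dest: spec[of _ 1])
qed

lemma symmetric_rank_plus_kernel:
  assumes E: "simple_graph E" and P: "subspace (symmetric_configurations S \<Phi>)"
    and p: "p \<in> symmetric_configurations S \<Phi>"
  shows "symmetric_rank E S \<Phi> p + dim (form_kernel (symmetric_configurations S \<Phi>) (euclidean_form E) p)
    = dim (symmetric_configurations S \<Phi>)"
proof -
  let ?P = "symmetric_configurations S \<Phi>"
  have "frechet_derivative (edge_function E) (at p within ?P) ` ?P = edge_derivative E p ` ?P"
    by (intro image_cong refl frechet_derivative_within_subspace P p edge_function_has_derivative)
  moreover have "edge_derivative E p u = 0 \<longleftrightarrow> euclidean_form E p u = 0" for u
  proof -
    have pair: "edge_derivative E p u $ {i, j} = 2 * euclidean_form E p u $ i $ j" for i j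
      by (cases "i = j") (auto simp: edge_derivative_def euclidean_form_def inner_diff_left inner_diff_right)
    show ?thesis
    proof
      assume "edge_derivative E p u = 0"
      then have "euclidean_form E p u $ i $ j = 0" for i j
        using pair[of i j] by simp
      then show "euclidean_form E p u = 0"
        by (simp add: vec_eq_iff)
    next
      assume eq: "euclidean_form E p u = 0"
      have "edge_derivative E p u $ e = 0" for e
      proof (cases "e \<in> E")
        case True
        then obtain i j where "e = {i, j}"
          using E by (auto simp: simple_graph_def card_2_iff)
        then show ?thesis
          using pair[of i j] eq by simp
      qed (simp add: edge_derivative_def)
      then show "edge_derivative E p u = 0"
        by (simp add: vec_eq_iff)
    qed
  qed
  moreover have "linear (edge_derivative E p)"
    using bilinear_edge_derivative by (auto simp: bilinear_def)
  ultimately show ?thesis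
    using dim_image_plus_kernel[OF _ P, of "edge_derivative E p"]
    by (simp add: symmetric_rank_def form_kernel_def)
qed

lemma S_regular_kernel_dim_le:
  assumes E: "simple_graph E" and P: "subspace (symmetric_configurations S \<Phi>)"
    and p: "p \<in> symmetric_configurations S \<Phi>" and reg: "S_regular E S \<Phi> p"
    and x: "x \<in> symmetric_configurations S \<Phi>"
  shows "dim (form_kernel (symmetric_configurations S \<Phi>) (euclidean_form E) p)
    \<le> dim (form_kernel (symmetric_configurations S \<Phi>) (euclidean_form E) x)"
proof -
  let ?P = "symmetric_configurations S \<Phi>"
  have "symmetric_rank E S \<Phi> ` ?P \<subseteq> {..dim ?P}"
    using symmetric_rank_plus_kernel[OF E P] by fastforce
  then have "finite (symmetric_rank E S \<Phi> ` ?P)"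
    by (rule finite_subset) simp
  then have "symmetric_rank E S \<Phi> x \<le> symmetric_rank E S \<Phi> p"
    using reg x unfolding S_regular_def by simp
  then show ?thesis
    using symmetric_rank_plus_kernel[OF E P p] symmetric_rank_plus_kernel[OF E P x] by simp
qed

section \<open>Flexes from nontrivial velocities\<close>

text \<open>
  A motion with initial velocity \<open>u\<close>, reparametrised to run over \<open>{0..1}\<close>, that avoids a condition
  \<open>C\<close> at all positive times. It suffices that \<open>u\<close> is incompatible with \<open>C\<close> holding at arbitrarily
  small positive times.
\<close>

lemma symmetric_form_flex_avoiding:
  fixes B :: "'a::euclidean_space \<Rightarrow> 'a \<Rightarrow> 'b::euclidean_space"
  assumes B: "bilinear B" "\<And>x y. B x y = B y x" and U: "subspace U" "p \<in> U"
    and u: "u \<in> form_kernel U B p" and e: "0 < e"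
    and dim: "\<And>x. x \<in> U \<Longrightarrow> dist x p < e \<Longrightarrow> dim (form_kernel U B p) \<le> dim (form_kernel U B x)"
    and avoid: "\<And>y. y 0 = p \<Longrightarrow> (y has_vector_derivative u) (at_right 0) \<Longrightarrow>
      \<exists>\<^sub>F s in at_right 0. C (y s) \<and> B (y s) (y s) = B p p \<Longrightarrow> False"
  shows "\<exists>y. analytic_path_on {0..1} y \<and> y 0 = p \<and>
    (\<forall>t\<in>{0..1}. y t \<in> U \<and> B (y t) (y t) = B p p) \<and> (\<forall>t\<in>{0<..1}. \<not> C (y t))"
proof -
  obtain y r where r: "0 < r" and y: "y 0 = p" "(y has_vector_derivative u) (at 0)"
    "\<And>t. \<bar>t\<bar> < r \<Longrightarrow> y t \<in> U \<and> B (y t) (y t) = B p p"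
    "\<And>s. 0 < s \<Longrightarrow> s < r \<Longrightarrow> analytic_path_on {0..1} (\<lambda>t. y (s * t))"
    using symmetric_form_flex[OF B U u e dim] by metis
  have "\<not> (\<exists>\<^sub>F s in at_right 0. C (y s) \<and> B (y s) (y s) = B p p)"
    using avoid[of y] y(1) has_vector_derivative_at_within[OF y(2)] by blast
  then have "\<forall>\<^sub>F s in at_right 0. \<not> (C (y s) \<and> B (y s) (y s) = B p p)"
    by (simp add: not_frequently)
  then obtain b where b: "0 < b" "\<And>s. 0 < s \<Longrightarrow> s < b \<Longrightarrow> \<not> (C (y s) \<and> B (y s) (y s) = B p p)"
    by (auto simp: eventually_at_right_field)
  define s where "s = min b r / 2"
  have s: "0 < s" "s < b" "s < r"
    using b r by (auto simp: s_def)
  have st: "\<bar>s * t\<bar> < r" "s * t < b" if "t \<in> {0..1}" for t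
    using that s by (auto simp: abs_mult intro: le_less_trans[OF mult_left_le])
  show ?thesis
  proof (intro exI[of _ "\<lambda>t. y (s * t)"] conjI ballI)
    show "\<not> C (y (s * t))" if "t \<in> {0<..1}" for t
      using b(2)[of "s * t"] st[of t] y(3)[of "s * t"] s that by auto
  qed (use y st s in auto)
qed

lemma sum_affine_dependency_norm:
  fixes x :: "'n::finite \<Rightarrow> 'a::real_inner"
  assumes "(\<Sum>i\<in>UNIV. c i) = 0"
  shows "(norm (\<Sum>i\<in>UNIV. c i *\<^sub>R x i))\<^sup>2
    = - (1/2) * (\<Sum>i\<in>UNIV. \<Sum>j\<in>UNIV. c i * c j * ((x i - x j) \<bullet> (x i - x j)))"
proof -
  have "(\<Sum>i\<in>UNIV. \<Sum>j\<in>UNIV. c i * c j * ((x i - x j) \<bullet> (x i - x j)))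
      = (\<Sum>i\<in>UNIV. \<Sum>j\<in>UNIV. c i * (x i \<bullet> x i) * c j) + (\<Sum>i\<in>UNIV. \<Sum>j\<in>UNIV. c i * (c j * (x j \<bullet> x j)))
        - 2 * (\<Sum>i\<in>UNIV. \<Sum>j\<in>UNIV. c i * c j * (x i \<bullet> x j))"
    by (simp add: inner_diff_left inner_diff_right inner_commute sum_distrib_left algebra_simps
        flip: sum.distrib sum_subtractf)
  also have "(\<Sum>i\<in>UNIV. \<Sum>j\<in>UNIV. c i * (x i \<bullet> x i) * c j) = 0"
    using assms by (simp flip: sum_distrib_left)
  also have "(\<Sum>i\<in>UNIV. \<Sum>j\<in>UNIV. c i * (c j * (x j \<bullet> x j))) = 0"
    using assms by (simp flip: sum_distrib_left sum_distrib_right)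
  also have "(\<Sum>i\<in>UNIV. \<Sum>j\<in>UNIV. c i * c j * (x i \<bullet> x j)) = (norm (\<Sum>i\<in>UNIV. c i *\<^sub>R x i))\<^sup>2"
    by (simp add: power2_norm_eq_inner inner_sum_left inner_sum_right sum_distrib_left mult_ac inner_commute)
  finally show ?thesis by simp
qed

lemma form_derivative_along_path:
  fixes B :: "'a::euclidean_space \<Rightarrow> 'a \<Rightarrow> 'b::euclidean_space"
  assumes B: "bilinear B" "\<And>x y. B x y = B y x"
    and y: "(y has_vector_derivative u) (at_right 0)" and freq: "\<exists>\<^sub>F s in at_right 0. B (y s) (y s) = B (y 0) (y 0)"
  shows "B (y 0) u = 0"
proof -
  have "((\<lambda>t. B (y t) (y t)) has_vector_derivative B (y 0) u + B u (y 0)) (at_right 0)"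
    by (rule bounded_bilinear.has_vector_derivative[OF B(1)[unfolded bilinear_conv_bounded_bilinear] y y])
  then have "B (y 0) u + B u (y 0) = 0"
    using freq by (rule vector_derivative_eq_zero)
  then show ?thesis
    by (simp add: B(2)[of u "y 0"] flip: scaleR_2)
qed

lemma combination_derivative_along_path:
  fixes y :: "real \<Rightarrow> 'a::euclidean_space^'n::finite"
  assumes y: "(y has_vector_derivative u) (at_right 0)"
    and freq: "\<exists>\<^sub>F s in at_right 0. (\<Sum>i\<in>UNIV. c i *\<^sub>R y s $ i) = (\<Sum>i\<in>UNIV. c i *\<^sub>R y 0 $ i)"
  shows "(\<Sum>i\<in>UNIV. c i *\<^sub>R u $ i) = 0"
proof -
  have "linear (\<lambda>x :: 'a^'n. \<Sum>i\<in>UNIV. c i *\<^sub>R x $ i)"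
    by (simp add: linear_iff scaleR_add_right sum.distrib scaleR_sum_right mult.commute)
  then have "bounded_linear (\<lambda>x :: 'a^'n. \<Sum>i\<in>UNIV. c i *\<^sub>R x $ i)"
    by (simp add: linear_conv_bounded_linear)
  from bounded_linear.has_vector_derivative[OF this y] freq show ?thesis
    by (rule vector_derivative_eq_zero)
qed

text \<open>
  If a motion with initial velocity \<open>u\<close> is congruent to \<open>p\<close> at arbitrarily small times, then
  \<open>u\<close> is trivial: at those times all distances are those of \<open>p\<close>, and so are, by
  \<open>sum_affine_dependency_norm\<close>, all affine dependencies.
\<close>

lemma symmetric_finite_flex_exists:
  fixes p :: "real^'d^'n::finite"
  assumes E: "simple_graph E" and P: "subspace (symmetric_configurations S \<Phi>)"
    and p: "p \<in> symmetric_configurations S \<Phi>"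
    and u: "u \<in> form_kernel (symmetric_configurations S \<Phi>) (euclidean_form E) p" "\<not> trivial_velocity p u"
    and dim: "\<And>x. x \<in> symmetric_configurations S \<Phi> \<Longrightarrow>
      dim (form_kernel (symmetric_configurations S \<Phi>) (euclidean_form E) p)
        \<le> dim (form_kernel (symmetric_configurations S \<Phi>) (euclidean_form E) x)"
  shows "\<exists>y. symmetric_finite_flex E S \<Phi> p y"
proof -
  let ?C = "\<lambda>x. euclidean_form complete_graph x x = euclidean_form complete_graph p p"
  have "\<exists>y. analytic_path_on {0..1} y \<and> y 0 = p \<and>
    (\<forall>t\<in>{0..1}. y t \<in> symmetric_configurations S \<Phi> \<and> euclidean_form E (y t) (y t) = euclidean_form E p p) \<and>
    (\<forall>t\<in>{0<..1}. \<not> ?C (y t))"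
  proof (rule symmetric_form_flex_avoiding[OF bilinear_euclidean_form euclidean_form_commute P p u(1) zero_less_one])
    fix y :: "real \<Rightarrow> real^'d^'n"
    assume y: "y 0 = p" "(y has_vector_derivative u) (at_right 0)"
      and "\<exists>\<^sub>F s in at_right 0. ?C (y s) \<and> euclidean_form E (y s) (y s) = euclidean_form E p p"
    then have freq: "\<exists>\<^sub>F s in at_right 0. ?C (y s)"
      by (auto elim: frequently_elim1)
    have "euclidean_form complete_graph p u = 0"
      using form_derivative_along_path[OF bilinear_euclidean_form euclidean_form_commute y(2), of complete_graph] freq y(1)
      by simp
    moreover have "(\<Sum>i\<in>UNIV. c i *\<^sub>R u $ i) = 0"
      if c: "(\<Sum>i\<in>UNIV. c i) = 0" "(\<Sum>i\<in>UNIV. c i *\<^sub>R p $ i) = 0" for c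
    proof (rule combination_derivative_along_path[OF y(2)])
      show "\<exists>\<^sub>F s in at_right 0. (\<Sum>i\<in>UNIV. c i *\<^sub>R y s $ i) = (\<Sum>i\<in>UNIV. c i *\<^sub>R y 0 $ i)"
        using freq
      proof (rule frequently_elim1)
        fix s
        assume eq: "?C (y s)"
        have "(y s $ i - y s $ j) \<bullet> (y s $ i - y s $ j) = (p $ i - p $ j) \<bullet> (p $ i - p $ j)" for i j
          using arg_cong[OF eq, of "\<lambda>f. f $ i $ j"]
          by (cases "i = j") (simp_all add: euclidean_form_def complete_graph_def)
        then have "(norm (\<Sum>i\<in>UNIV. c i *\<^sub>R y s $ i))\<^sup>2 = (norm (\<Sum>i\<in>UNIV. c i *\<^sub>R p $ i))\<^sup>2"
          unfolding sum_affine_dependency_norm[OF c(1)] by simp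
        then show "(\<Sum>i\<in>UNIV. c i *\<^sub>R y s $ i) = (\<Sum>i\<in>UNIV. c i *\<^sub>R y 0 $ i)"
          using c(2) by (simp add: y(1))
      qed
    qed
    ultimately have "trivial_velocity p u"
      by (simp add: trivial_velocity_def euclidean_form_complete_eq_0_iff)
    with u(2) show False ..
  qed (rule dim)
  then obtain y where "analytic_path_on {0..1} y" "y 0 = p"
    "\<And>t. t \<in> {0..1} \<Longrightarrow> y t \<in> symmetric_configurations S \<Phi> \<and> euclidean_form E (y t) (y t) = euclidean_form E p p"
    "\<And>t. t \<in> {0<..1} \<Longrightarrow> \<not> ?C (y t)"
    by blast
  then have "symmetric_finite_flex E S \<Phi> p y"
    unfolding symmetric_finite_flex_def finite_flex_def finite_motion_def
      edge_function_eq_iff[OF E] edge_function_eq_iff[OF simple_complete_graph] by simp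
  then show ?thesis by blast
qed

text \<open>
  A null vector that is orthogonal to a timelike vector vanishes. This replaces
  positive definiteness in the argument about linear dependencies below.
\<close>

lemma minkowski_inner_orthogonal_timelike_eq_0:
  assumes a: "minkowski_inner a a < 0" and z: "minkowski_inner z a = 0" "minkowski_inner z z = 0"
  shows "z = 0"
proof -
  have sq: "(norm (fst a))\<^sup>2 < \<bar>snd a\<bar>\<^sup>2" "(norm (fst z))\<^sup>2 = \<bar>snd z\<bar>\<^sup>2"
    using a z(2) unfolding minkowski_inner_def power2_norm_eq_inner power2_abs by (simp_all add: power2_eq_square)
  have norm: "norm (fst a) < \<bar>snd a\<bar>" "norm (fst z) = \<bar>snd z\<bar>"
    using power2_less_imp_less[OF sq(1)] power2_eq_imp_eq[OF sq(2)] by auto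
  have "snd z = 0"
  proof (rule ccontr)
    assume "snd z \<noteq> 0"
    have "\<bar>snd z\<bar> * \<bar>snd a\<bar> = \<bar>fst z \<bullet> fst a\<bar>"
      using z(1) by (simp add: minkowski_inner_def abs_mult)
    also have "\<dots> \<le> norm (fst z) * norm (fst a)"
      by (rule Cauchy_Schwarz_ineq2)
    also have "\<dots> < \<bar>snd z\<bar> * \<bar>snd a\<bar>"
      using norm \<open>snd z \<noteq> 0\<close> by simp
    finally show False by simp
  qed
  then show ?thesis
    using norm(2) by (simp add: prod_eq_iff)
qed

lemma hyperbolic_form_eq_iff:
  fixes x q :: "((real^'d) \<times> real)^'n::finite"
  shows "hyperbolic_form E x x = hyperbolic_form E q q \<longleftrightarrow>
    (\<forall>i. minkowski_inner (x $ i) (x $ i) = minkowski_inner (q $ i) (q $ i)) \<and>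
    (\<forall>i j. {i, j} \<in> E \<longrightarrow> minkowski_inner (x $ i) (x $ j) = minkowski_inner (q $ i) (q $ j))"
proof -
  have "hyperbolic_form E x x $ i $ j = (if i = j \<or> {i, j} \<in> E then 2 * minkowski_inner (x $ i) (x $ j) else 0)"
    for x :: "((real^'d) \<times> real)^'n" and i j
    using minkowski_inner_commute[of "x $ j" "x $ i"] by (simp add: hyperbolic_form_def)
  then show ?thesis
    by (auto simp: vec_eq_iff)
qed

text \<open>
  The hyperbolic counterpart of \<open>symmetric_finite_flex_exists\<close>. The affine dependencies are replaced by linear
  dependencies of the position vectors: if the products \<open>y\<^sub>i \<cdot> y\<^sub>j\<close> agree with those of \<open>q\<close> and
  \<open>\<Sum>c\<^sub>i q\<^sub>i = 0\<close>, then \<open>\<Sum>c\<^sub>i y\<^sub>i\<close> is null and orthogonal to each \<open>y\<^sub>j\<close>, which is timelike.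
\<close>

lemma symmetric_hyperbolic_flex_exists:
  fixes q :: "((real^'d) \<times> real)^'n::finite"
  assumes U: "subspace (symmetric_minkowski_configurations S \<Phi>)"
    and q: "q \<in> symmetric_minkowski_configurations S \<Phi>" and sheet: "\<And>i. minkowski_inner (q $ i) (q $ i) = -1"
    and v: "v \<in> form_kernel (symmetric_minkowski_configurations S \<Phi>) (hyperbolic_form E) q"
    and nontrivial: "hyperbolic_form complete_graph q v = 0 \<Longrightarrow>
      (\<And>c. (\<Sum>i\<in>UNIV. c i *\<^sub>R q $ i) = 0 \<Longrightarrow> (\<Sum>i\<in>UNIV. c i *\<^sub>R v $ i) = 0) \<Longrightarrow> False"
    and e: "0 < e"
    and dim: "\<And>x. x \<in> symmetric_minkowski_configurations S \<Phi> \<Longrightarrow> dist x q < e \<Longrightarrow>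
      dim (form_kernel (symmetric_minkowski_configurations S \<Phi>) (hyperbolic_form E) q)
        \<le> dim (form_kernel (symmetric_minkowski_configurations S \<Phi>) (hyperbolic_form E) x)"
  shows "\<exists>y. analytic_path_on {0..1} y \<and> y 0 = q \<and>
    (\<forall>t\<in>{0..1}. y t \<in> symmetric_minkowski_configurations S \<Phi> \<and>
      hyperbolic_form E (y t) (y t) = hyperbolic_form E q q) \<and>
    (\<forall>t\<in>{0<..1}. hyperbolic_form complete_graph (y t) (y t) \<noteq> hyperbolic_form complete_graph q q)"
proof (rule symmetric_form_flex_avoiding[OF bilinear_hyperbolic_form hyperbolic_form_commute U q v e])
  let ?C = "\<lambda>x. hyperbolic_form complete_graph x x = hyperbolic_form complete_graph q q"
  fix y :: "real \<Rightarrow> ((real^'d) \<times> real)^'n"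
  assume y: "y 0 = q" "(y has_vector_derivative v) (at_right 0)"
    and "\<exists>\<^sub>F s in at_right 0. ?C (y s) \<and> hyperbolic_form E (y s) (y s) = hyperbolic_form E q q"
  then have freq: "\<exists>\<^sub>F s in at_right 0. ?C (y s)"
    by (auto elim: frequently_elim1)
  show False
  proof (rule nontrivial)
    show "hyperbolic_form complete_graph q v = 0"
      using form_derivative_along_path[OF bilinear_hyperbolic_form hyperbolic_form_commute y(2), of complete_graph] freq y(1)
      by simp
    show "(\<Sum>i\<in>UNIV. c i *\<^sub>R v $ i) = 0" if c: "(\<Sum>i\<in>UNIV. c i *\<^sub>R q $ i) = 0" for c
    proof (rule combination_derivative_along_path[OF y(2)])
      show "\<exists>\<^sub>F s in at_right 0. (\<Sum>i\<in>UNIV. c i *\<^sub>R y s $ i) = (\<Sum>i\<in>UNIV. c i *\<^sub>R y 0 $ i)"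
        using freq
      proof (rule frequently_elim1)
        fix s
        assume eq: "?C (y s)"
        have pair: "minkowski_inner (y s $ i) (y s $ j) = minkowski_inner (q $ i) (q $ j)" for i j
          using eq[unfolded hyperbolic_form_eq_iff] by (cases "i = j") (auto simp: complete_graph_def)
        define z where "z = (\<Sum>i\<in>UNIV. c i *\<^sub>R y s $ i)"
        have lin: "minkowski_inner (\<Sum>i\<in>UNIV. c i *\<^sub>R r $ i) w = (\<Sum>i\<in>UNIV. c i * minkowski_inner (r $ i) w)"
          for r :: "((real^'d) \<times> real)^'n" and w
          by (simp add: minkowski_inner_def fst_sum snd_sum inner_sum_left sum_distrib_right sum_subtractf
              right_diff_distrib mult.assoc)
        have zy: "minkowski_inner z (y s $ j) = 0" for j
        proof -
          have "minkowski_inner z (y s $ j) = minkowski_inner (\<Sum>i\<in>UNIV. c i *\<^sub>R q $ i) (q $ j)"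
            unfolding z_def lin pair ..
          then show ?thesis
            by (simp add: c minkowski_inner_def)
        qed
        have "minkowski_inner z z = (\<Sum>i\<in>UNIV. c i * minkowski_inner (y s $ i) z)"
          by (subst (1) z_def) (rule lin)
        moreover have "minkowski_inner (y s $ i) z = 0" for i
          using zy[of i] minkowski_inner_commute[of z "y s $ i"] by simp
        ultimately have "minkowski_inner z z = 0"
          by simp
        moreover obtain j :: 'n where True by simp
        ultimately have "z = 0"
          using zy[of j] pair[of j j] sheet[of j]
          by (intro minkowski_inner_orthogonal_timelike_eq_0[of "y s $ j"]) auto
        then show "(\<Sum>i\<in>UNIV. c i *\<^sub>R y s $ i) = (\<Sum>i\<in>UNIV. c i *\<^sub>R y 0 $ i)"
          by (simp add: z_def y(1) c)
      qed
    qed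
  qed
qed (rule dim)

text \<open>
  A velocity whose lift preserves all Minkowski products to first order and respects all linear
  dependencies is trivial.
\<close>

lemma velocity_lift_trivialD:
  fixes q :: "((real^'d) \<times> real)^'n::finite"
  assumes q0: "\<And>i. snd (q $ i) \<noteq> 0" and form: "hyperbolic_form complete_graph q (velocity_lift q u) = 0"
    and dep: "\<And>c. (\<Sum>i\<in>UNIV. c i *\<^sub>R q $ i) = 0 \<Longrightarrow> (\<Sum>i\<in>UNIV. c i *\<^sub>R velocity_lift q u $ i) = 0"
  shows "trivial_velocity (central_projection q) u"
  unfolding trivial_velocity_def
proof (intro conjI allI impI)
  fix i j
  have "minkowski_inner (q $ i) (velocity_lift q u $ j) + minkowski_inner (q $ j) (velocity_lift q u $ i) = 0" if "i \<noteq> j"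
    using arg_cong[OF form, of "\<lambda>f. f $ i $ j"] that by (simp add: hyperbolic_form_def complete_graph_def)
  then show "(central_projection q $ i - central_projection q $ j) \<bullet> (u $ i - u $ j) = 0"
    using q0 by (cases "i = j") (auto simp: minkowski_inner_velocity_lift[OF q0])
next
  fix c :: "'n \<Rightarrow> real"
  assume c: "(\<Sum>i\<in>UNIV. c i) = 0" "(\<Sum>i\<in>UNIV. c i *\<^sub>R central_projection q $ i) = 0"
  \<comment> \<open>An affine dependency of the projected points becomes a linear one of the vectors \<open>q $ i\<close> on division by their last coordinates.\<close>
  define c' where "c' i = c i * inverse (snd (q $ i))" for i
  have "(\<Sum>i\<in>UNIV. c' i *\<^sub>R q $ i) = 0"
    using c by (simp add: prod_eq_iff fst_sum snd_sum c'_def q0 central_projection_def mult.assoc)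
  from arg_cong[OF dep[OF this], of fst]
  show "(\<Sum>i\<in>UNIV. c i *\<^sub>R u $ i) = 0"
    by (simp add: fst_sum c'_def velocity_lift_def q0 mult.assoc)
qed

lemma central_projection_near:
  fixes q :: "((real^'d) \<times> real)^'n::finite"
  assumes q0: "\<And>i. snd (q $ i) \<noteq> 0" and e: "0 < e"
  obtains d where "0 < d" and "\<And>x i. dist x q < d \<Longrightarrow> snd (x $ i) \<noteq> 0"
    and "\<And>x. dist x q < d \<Longrightarrow> dist (central_projection x) (central_projection q) < e"
proof -
  have comp: "((\<lambda>x. x $ i) \<longlongrightarrow> q $ i) (nhds q)" for i
    by (intro tendsto_vec_nth filterlim_ident)
  have "(central_projection \<longlongrightarrow> central_projection q) (nhds q)"
    unfolding central_projection_def
    by (intro tendsto_vec_lambda tendsto_scaleR tendsto_inverse tendsto_fst tendsto_snd comp q0)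
  then have "\<forall>\<^sub>F x in nhds q. dist (central_projection x) (central_projection q) < e"
    using e by (rule tendstoD)
  moreover have "\<forall>\<^sub>F x in nhds q. \<forall>i. snd (x $ i) \<noteq> 0"
    by (intro eventually_all_finite tendsto_imp_eventually_ne[OF tendsto_snd[OF comp]] q0)
  ultimately have "\<forall>\<^sub>F x in nhds q. dist (central_projection x) (central_projection q) < e \<and> (\<forall>i. snd (x $ i) \<noteq> 0)"
    by (rule eventually_conj)
  then show thesis
    unfolding eventually_nhds_metric using that by blast
qed

section \<open>Comparison of Euclidean and hyperbolic flexes\<close>

text \<open>
  The two frameworks have the same type, since projection to \<open>p\<close> commutes with the
  symmetries and \<open>p\<close> is injective.
\<close>

lemma hyperbolic_type_star:
  fixes p :: "real^'d^'n::finite" and q :: "((real^'d) \<times> real)^'n"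
  assumes p: "inj (($) p)" "is_type E S p \<Phi>" and q: "is_hyperbolic_type E S q \<Psi>" "projects_to q p"
    and S: "\<And>x. x \<in> S \<Longrightarrow> linear x" and x: "x \<in> S"
  shows "\<Psi> (star x) i = \<Phi> x i"
proof -
  define k where "k = \<Psi> (star x) i"
  have image: "star x (q $ i) = q $ k"
    using q(1) x by (auto simp: is_hyperbolic_type_def star_group_def k_def)
  obtain \<alpha> where \<alpha>: "\<And>i. \<alpha> i \<noteq> 0" "\<And>i. q $ i = \<alpha> i *\<^sub>R (p $ i, 1)"
    using q(2) unfolding projects_to_def by metis
  have "star x (q $ i) = (\<alpha> i *\<^sub>R x (p $ i), \<alpha> i)" "q $ k = (\<alpha> k *\<^sub>R p $ k, \<alpha> k)"
    by (simp_all add: \<alpha>(2) star_def linear_cmul[OF S[OF x]])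
  then have "x (p $ i) = p $ k"
    using image \<alpha>(1)[of i] by (metis prod.inject scaleR_cancel_left)
  moreover have "x (p $ i) = p $ \<Phi> x i"
    using p(2) x by (simp add: is_type_def)
  ultimately show ?thesis
    using p(1) by (simp add: inj_eq k_def)
qed

lemma minkowski_sq_eq_inner: "minkowski_sq a = minkowski_inner a a"
  unfolding minkowski_sq_def minkowski_inner_def power2_norm_eq_inner by (simp add: power2_eq_square)

lemma minkowski_sq_diff_eq_iff:
  assumes "minkowski_inner a a = minkowski_inner a' a'" "minkowski_inner b b = minkowski_inner b' b'"
  shows "minkowski_sq (a - b) = minkowski_sq (a' - b') \<longleftrightarrow> minkowski_inner a b = minkowski_inner a' b'"
proof -
  have "minkowski_sq (a - b) = minkowski_inner a a + minkowski_inner b b - 2 * minkowski_inner a b" for a b :: "(real^'d) \<times> real"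
    by (simp add: minkowski_sq_eq_inner minkowski_inner_def inner_diff_left inner_diff_right inner_commute algebra_simps)
  from this[of a b] this[of a' b'] show ?thesis
    using assms by simp
qed

theorem theorem5p5:
  fixes E :: "'n::finite set set"
    and S :: "(real^'d \<Rightarrow> real^'d) set"
    and p :: "real^'d^'n"
    and q :: "((real^'d) \<times> real)^'n"
    and \<Phi> :: "(real^'d \<Rightarrow> real^'d) \<Rightarrow> 'n \<Rightarrow> 'n"
    and \<Psi> :: "((real^'d) \<times> real \<Rightarrow> (real^'d) \<times> real) \<Rightarrow> 'n \<Rightarrow> 'n"
  assumes "symmetry_group S"
    and "p \<in> symmetric_frameworks E S"
    and "is_type E S p \<Phi>"
    and "S_regular E S \<Phi> p"
    and "hyperbolic_framework E q"
    and "is_hyperbolic_type E S q \<Psi>"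
    and "projects_to q p"
  shows "(\<exists>y. symmetric_finite_flex E S \<Phi> p y) \<longleftrightarrow>
         (\<exists>y. symmetric_hyperbolic_finite_flex E S \<Psi> q y)"
proof -
  let ?P = "symmetric_configurations S \<Phi>" and ?M = "symmetric_minkowski_configurations S \<Phi>"
  let ?K = "form_kernel ?P (euclidean_form E)" and ?KM = "form_kernel ?M (hyperbolic_form E)"
  have orth: "orthogonal_transformation x" if "x \<in> S" for x
    using subgroup.subset[OF assms(1)] that by (auto simp: orthogonal_group_def)
  have lin: "linear x" if "x \<in> S" for x
    using orth[OF that] by (rule orthogonal_transformation_linear)
  have bij: "bij (\<Phi> x)" if "x \<in> S" for x
    using assms(3) that by (auto simp: is_type_def Aut_def)
  have E: "simple_graph E" and inj: "inj (($) p)"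
    using assms(2) by (auto simp: symmetric_frameworks_def framework_def)
  have P: "subspace ?P" and M: "subspace ?M"
    using lin by (auto intro: subspace_symmetric_configurations subspace_symmetric_minkowski_configurations)
  have p: "p \<in> ?P"
    using assms(3) by (simp add: is_type_def symmetric_configurations_def)
  have \<Psi>: "\<Psi> (star x) = \<Phi> x" if "x \<in> S" for x
    using hyperbolic_type_star[OF inj assms(3,6,7) lin that] by (rule ext)
  have symmetric: "(\<forall>z\<in>carrier (star_group S). \<forall>i. z (r $ i) = r $ \<Psi> z i) \<longleftrightarrow> r \<in> ?M" for r
    using \<Psi> by (simp add: star_group_def symmetric_minkowski_configurations_def)
  have q: "q \<in> ?M"
    using assms(6) symmetric[of q] by (simp add: is_hyperbolic_type_def)
  have sheet: "minkowski_inner (q $ i) (q $ i) = -1" for i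
    using assms(5) by (simp add: hyperbolic_framework_def hyperbolic_space_def minkowski_sq_eq_inner)
  obtain \<alpha> where \<alpha>: "\<And>i. \<alpha> i \<noteq> 0" "\<And>i. q $ i = \<alpha> i *\<^sub>R (p $ i, 1)"
    using assms(7) unfolding projects_to_def by metis
  have q0: "snd (q $ i) \<noteq> 0" for i
    using \<alpha> by simp
  have proj: "central_projection q = p"
    using \<alpha> by (simp add: central_projection_def vec_eq_iff)
  have dim: "dim (?K p) \<le> dim (?K x)" if "x \<in> ?P" for x
    using that by (rule S_regular_kernel_dim_le[OF E P p assms(4)])
  have hyperbolic_flex: "(\<exists>y. symmetric_hyperbolic_finite_flex E S \<Psi> q y) \<longleftrightarrow>
      (\<exists>y. analytic_path_on {0..1} y \<and> y 0 = q \<and>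
        (\<forall>t\<in>{0..1}. y t \<in> ?M \<and> (\<forall>i. minkowski_inner (y t $ i) (y t $ i) = -1) \<and>
          hyperbolic_form E (y t) (y t) = hyperbolic_form E q q) \<and>
        (\<forall>t\<in>{0<..1}. hyperbolic_form complete_graph (y t) (y t) \<noteq> hyperbolic_form complete_graph q q))"
  proof -
    have form: "hyperbolic_form G x x = hyperbolic_form G q q \<longleftrightarrow>
        (\<forall>i j. {i, j} \<in> G \<longrightarrow> minkowski_sq (x $ i - x $ j) = minkowski_sq (q $ i - q $ j))"
      if "\<forall>i. minkowski_inner (x $ i) (x $ i) = -1" for G and x :: "((real^'d) \<times> real)^'n"
      using that sheet by (simp add: hyperbolic_form_eq_iff minkowski_sq_diff_eq_iff)
    have complete: "hyperbolic_form complete_graph x x \<noteq> hyperbolic_form complete_graph q q \<longleftrightarrow>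
        (\<exists>i j. minkowski_sq (x $ i - x $ j) \<noteq> minkowski_sq (q $ i - q $ j))"
      if "\<forall>i. minkowski_inner (x $ i) (x $ i) = -1" for x :: "((real^'d) \<times> real)^'n"
    proof -
      have "{i, j} \<in> complete_graph \<longleftrightarrow> i \<noteq> j" for i j :: 'n
        by (cases "i = j") (auto simp: complete_graph_def)
      then show ?thesis
        unfolding form[OF that] by (metis diff_self)
    qed
    have sheets: "(\<forall>t\<in>{0..1}. \<forall>i. y t $ i \<in> hyperbolic_space) \<longleftrightarrow>
        (\<forall>t\<in>{0..1}. \<forall>i. minkowski_inner (y t $ i) (y t $ i) = -1)" for y :: "real \<Rightarrow> ((real^'d) \<times> real)^'n"
      by (simp add: hyperbolic_space_def minkowski_sq_eq_inner)
    have "symmetric_hyperbolic_finite_flex E S \<Psi> q y \<longleftrightarrow>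
      analytic_path_on {0..1} y \<and> y 0 = q \<and>
        (\<forall>t\<in>{0..1}. y t \<in> ?M \<and> (\<forall>i. minkowski_inner (y t $ i) (y t $ i) = -1) \<and>
          hyperbolic_form E (y t) (y t) = hyperbolic_form E q q) \<and>
        (\<forall>t\<in>{0<..1}. hyperbolic_form complete_graph (y t) (y t) \<noteq> hyperbolic_form complete_graph q q)" for y
    proof (cases "\<forall>t\<in>{0..1}. \<forall>i. minkowski_inner (y t $ i) (y t $ i) = -1")
      case True
      then have "(\<forall>t\<in>{0<..1}. hyperbolic_form complete_graph (y t) (y t) \<noteq> hyperbolic_form complete_graph q q) \<longleftrightarrow>
          (\<forall>t\<in>{0<..1}. \<exists>i j. minkowski_sq (y t $ i - y t $ j) \<noteq> minkowski_sq (q $ i - q $ j))"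
        using complete by (intro ball_cong refl) simp
      moreover have "(\<forall>t\<in>{0..1}. hyperbolic_form E (y t) (y t) = hyperbolic_form E q q) \<longleftrightarrow>
          (\<forall>t\<in>{0..1}. \<forall>i j. {i, j} \<in> E \<longrightarrow> minkowski_sq (y t $ i - y t $ j) = minkowski_sq (q $ i - q $ j))"
        using True form by (intro ball_cong refl) simp
      ultimately show ?thesis
        using True unfolding symmetric_hyperbolic_finite_flex_def hyperbolic_finite_flex_def symmetric sheets
        by blast
    next
      case False
      then show ?thesis
        unfolding symmetric_hyperbolic_finite_flex_def hyperbolic_finite_flex_def sheets by blast
    qed
    then show ?thesis by simp
  qed
  show ?thesis
  proof (cases "\<forall>u\<in>?K p. trivial_velocity p u")
    case True
    \<comment> \<open>The framework is infinitesimally rigid, and neither framework has a flex.\<close>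
    then obtain e where e: "0 < e"
      and rigid: "\<And>x. x \<in> ?P \<Longrightarrow> dist x p < e \<Longrightarrow> ?K x \<subseteq> form_kernel ?P (euclidean_form complete_graph) x"
      using rigid_near_rigid[OF orth bij p, of E] by blast
    obtain d where d: "0 < d" "\<And>x i. dist x q < d \<Longrightarrow> snd (x $ i) \<noteq> 0"
      "\<And>x. dist x q < d \<Longrightarrow> dist (central_projection x) p < e"
      using central_projection_near[of q e] q0 e unfolding proj by metis
    have "\<not> symmetric_finite_flex E S \<Phi> p y" for y
    proof
      assume y: "symmetric_finite_flex E S \<Phi> p y"
      then have y': "analytic_path_on {0..1} y" "y 0 = p" "\<And>t. t \<in> {0..1} \<Longrightarrow> y t \<in> ?P"
        "\<And>t. t \<in> {0..1} \<Longrightarrow> euclidean_form E (y t) (y t) = euclidean_form E p p"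
        "\<And>t. t \<in> {0<..1} \<Longrightarrow> euclidean_form complete_graph (y t) (y t) \<noteq> euclidean_form complete_graph p p"
        unfolding symmetric_finite_flex_def finite_flex_def finite_motion_def
          edge_function_eq_iff[OF E] edge_function_eq_iff[OF simple_complete_graph] by auto
      have "\<exists>t\<in>{0<..1}. euclidean_form complete_graph (y t) (y t) = euclidean_form complete_graph (y 0) (y 0)"
        using rigid y'(1-4)
        by (intro analytic_motion_preserves_form[OF bilinear_euclidean_form euclidean_form_commute
              bilinear_euclidean_form euclidean_form_commute P e, of y E]) simp_all
      then show False
        using y'(2,5) by auto
    qed
    moreover have "\<not> symmetric_hyperbolic_finite_flex E S \<Psi> q y" for y
    proof
      assume "symmetric_hyperbolic_finite_flex E S \<Psi> q y"
      then obtain y where y: "analytic_path_on {0..1} y" "y 0 = q" "\<And>t. t \<in> {0..1} \<Longrightarrow> y t \<in> ?M"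
        "\<And>t. t \<in> {0..1} \<Longrightarrow> hyperbolic_form E (y t) (y t) = hyperbolic_form E q q"
        "\<And>t. t \<in> {0<..1} \<Longrightarrow> hyperbolic_form complete_graph (y t) (y t) \<noteq> hyperbolic_form complete_graph q q"
        using hyperbolic_flex by blast
      have "?KM x \<subseteq> form_kernel ?M (hyperbolic_form complete_graph) x" if x: "x \<in> ?M" "dist x q < d" for x
      proof -
        have image: "form_kernel ?M (hyperbolic_form G) x
            = velocity_lift x ` form_kernel ?P (euclidean_form G) (central_projection x)" for G
          by (rule velocity_lift_image_kernel[symmetric]) (use x d(2) orth in auto)
        have "central_projection x \<in> ?P"
          using x(1) lin by (rule central_projection_mem)
        then show ?thesis
          unfolding image using d(3)[OF x(2)] by (intro image_mono rigid)
      qed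
      then have "\<exists>t\<in>{0<..1}. hyperbolic_form complete_graph (y t) (y t) = hyperbolic_form complete_graph (y 0) (y 0)"
        using y(1-4)
        by (intro analytic_motion_preserves_form[OF bilinear_hyperbolic_form hyperbolic_form_commute
              bilinear_hyperbolic_form hyperbolic_form_commute M d(1), of y E]) simp_all
      then show False
        using y(2,5) by auto
    qed
    ultimately show ?thesis by blast
  next
    case False
    \<comment> \<open>A nontrivial infinitesimal motion integrates to a flex in both geometries.\<close>
    then obtain u where u: "u \<in> ?K p" "\<not> trivial_velocity p u"
      by blast
    have "\<exists>y. symmetric_finite_flex E S \<Phi> p y"
      by (rule symmetric_finite_flex_exists[OF E P p u dim])
    moreover have "\<exists>y. symmetric_hyperbolic_finite_flex E S \<Psi> q y"
    proof -
      obtain d where d: "0 < d" "\<And>x i. dist x q < d \<Longrightarrow> snd (x $ i) \<noteq> 0"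
        using central_projection_near[OF q0 zero_less_one] by metis
      have v: "velocity_lift q u \<in> ?KM q"
        using u(1) velocity_lift_image_kernel[OF q q0 orth, of E] unfolding proj by blast
      have "dim (?KM q) \<le> dim (?KM x)" if x: "x \<in> ?M" "dist x q < d" for x
      proof -
        have "central_projection x \<in> ?P"
          using x(1) lin by (rule central_projection_mem)
        moreover have "dim (?KM x) = dim (?K (central_projection x))"
          by (rule dim_hyperbolic_kernel) (use x d(2) orth in auto)
        moreover have "dim (?KM q) = dim (?K p)"
          using dim_hyperbolic_kernel[OF q q0] orth proj by auto
        ultimately show ?thesis
          using dim by simp
      qed
      then obtain y where y: "analytic_path_on {0..1} y" "y 0 = q"
        "\<And>t. t \<in> {0..1} \<Longrightarrow> y t \<in> ?M \<and> hyperbolic_form E (y t) (y t) = hyperbolic_form E q q"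
        "\<And>t. t \<in> {0<..1} \<Longrightarrow> hyperbolic_form complete_graph (y t) (y t) \<noteq> hyperbolic_form complete_graph q q"
        using symmetric_hyperbolic_flex_exists[OF M q sheet v _ d(1)]
          velocity_lift_trivialD[OF q0, of u, unfolded proj] u(2) by blast
      moreover have "minkowski_inner (y t $ i) (y t $ i) = -1" if "t \<in> {0..1}" for t i
        using y(3)[OF that] sheet[of i] by (simp add: hyperbolic_form_eq_iff)
      ultimately show ?thesis
        unfolding hyperbolic_flex by blast
    qed
    ultimately show ?thesis by blast
  qed
qed

end
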